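(* For every $\varepsilon>0$ there exists a constant $K(\varepsilon)>0$ such that if $p\geq K\log n/n$ and $G\sim G(n,p)$, then with probability tending to $1$ as $n\to\infty$, $$r_\ell(G,\mathcal{HAM})\geq (1-\varepsilon)np/6.$$
   Context: $G(n,p)$ is the binomial random graph on vertex set $[n]$ in which each pair is an edge independently with probability $p$. For a monotone increasing graph property $\mathcal{P}$ and a graph $G$, the local resilience is $r_\ell(G,\mathcal{P})=\min\{r: \exists H\subseteq G \text{ with } \Delta(H)=r \text{ and } G- H\notin\mathcal{P}\}$, where $H\subseteq G$ is a subgraph on the same vertex set, $\Delta(H)$ its maximum degree, and $G-H$ the graph obtained by deleting the edges of $H$. $\mathcal{HAM}$ denotes the property of being Hamiltonian. *)

theory Defs
  imports "HOL-Probability.Probability"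
begin

text \<open>
  A graph is a pair of a vertex set and a set of edges, an edge being a two-element set of
  vertices. A graph property is a set of graphs.
\<close>

type_synonym 'a graph = "'a set \<times> 'a set set"

definition verts :: "'a graph \<Rightarrow> 'a set" where
  "verts G = fst G"

definition edges :: "'a graph \<Rightarrow> 'a set set" where
  "edges G = snd G"

definition spanning_subgraph :: "'a graph \<Rightarrow> 'a graph \<Rightarrow> bool" where
  "spanning_subgraph H G \<longleftrightarrow> verts H = verts G \<and> edges H \<subseteq> edges G"

definition delete_edges :: "'a graph \<Rightarrow> 'a graph \<Rightarrow> 'a graph" where
  "delete_edges G H = (verts G, edges G - edges H)"

definition vertex_degree :: "'a graph \<Rightarrow> 'a \<Rightarrow> nat" where
  "vertex_degree G v = card {e \<in> edges G. v \<in> e}"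

definition max_degree :: "'a graph \<Rightarrow> nat" where
  "max_degree G = Max (vertex_degree G ` verts G)"

definition monotone_increasing :: "'a graph set \<Rightarrow> bool" where
  "monotone_increasing P \<longleftrightarrow> (\<forall>H G. spanning_subgraph H G \<longrightarrow> H \<in> P \<longrightarrow> G \<in> P)"

text \<open>
  \<open>Inf\<close> on the naturals is the minimum of a nonempty set and \<open>0\<close> on the empty set. The set is
  nonempty as soon as the edgeless graph on the vertices of \<open>G\<close> is not in \<open>P\<close>; for
  Hamiltonicity this always holds, see \<open>local_resilience_HAM_attained\<close> below.
\<close>

definition local_resilience :: "'a graph \<Rightarrow> 'a graph set \<Rightarrow> nat" where
  "local_resilience G P =
     Inf {r. \<exists>H. spanning_subgraph H G \<and> max_degree H = r \<and> delete_edges G H \<notin> P}"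

text \<open>
  The list enumerates the vertices in the cyclic order of a Hamilton cycle. Cycles have length at
  least three, so graphs on fewer than three vertices are not Hamiltonian.
\<close>

definition hamilton_cycle :: "'a graph \<Rightarrow> 'a list \<Rightarrow> bool" where
  "hamilton_cycle G xs \<longleftrightarrow>
     distinct xs \<and> set xs = verts G \<and> length xs \<ge> 3 \<and>
     (\<forall>i < length xs. {xs ! i, xs ! (Suc i mod length xs)} \<in> edges G)"

definition HAM :: "'a graph set" where
  "HAM = {G. \<exists>xs. hamilton_cycle G xs}"

definition vertex_pairs :: "nat \<Rightarrow> nat set set" where
  "vertex_pairs n = {e. e \<subseteq> {1..n} \<and> card e = 2}"

definition binomial_random_graph :: "nat \<Rightarrow> real \<Rightarrow> nat graph pmf" where
  "binomial_random_graph n p =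
     map_pmf (\<lambda>X. ({1..n}, {e \<in> vertex_pairs n. X e}))
       (Pi_pmf (vertex_pairs n) False (\<lambda>_. bernoulli_pmf p))"

lemma monotone_increasing_HAM: "monotone_increasing HAM"
  unfolding monotone_increasing_def HAM_def hamilton_cycle_def spanning_subgraph_def
  by auto blast

lemma local_resilience_HAM_attained:
  "\<exists>H. spanning_subgraph H G \<and> max_degree H = local_resilience G HAM \<and> delete_edges G H \<notin> HAM"
proof -
  let ?R = "{r. \<exists>H. spanning_subgraph H G \<and> max_degree H = r \<and> delete_edges G H \<notin> HAM}"
  have "spanning_subgraph G G" "delete_edges G G \<notin> HAM"
    by (auto simp: spanning_subgraph_def delete_edges_def HAM_def hamilton_cycle_def edges_def
        intro!: exI[of _ 0])
  then have "?R \<noteq> {}"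
    by blast
  then have "Inf ?R \<in> ?R"
    by (rule Inf_nat_def1)
  then show ?thesis
    unfolding local_resilience_def by auto
qed

end

theory Submission
  imports Defs "HOL-Real_Asymp.Real_Asymp"
begin

text \<open>
  Write \<open>d = n p\<close> and let \<open>H\<close> have maximum degree at most \<open>d / 6\<close>. Every large cut of \<open>G\<close> and every
  star of \<open>G\<close> has more edges than \<open>H\<close> can remove, and small sets span few edges of \<open>G\<close>. Hence
  \<open>G - H\<close> contains a subgraph with at most \<open>2 \<delta> n d\<close> edges in which every set \<open>S\<close> of at most \<open>n / 4\<close>
  vertices has more than \<open>2 |S|\<close> neighbours outside: take \<open>\<delta> d\<close> edges at each vertex for the small
  sets, and a greedy hitting set of linear size for the large cuts.

  By Posa rotations, a non-Hamiltonian expander \<open>\<Gamma>\<close> has, for suitable \<open>A\<close> of size about \<open>n / 24\<close>, more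
  than \<open>|A| (n / 4 - |A|)\<close> boosters meeting \<open>A\<close>, that is, non-edges whose addition creates a Hamilton
  cycle or a longer path. About a \<open>p\<close>-fraction of them lies in \<open>G\<close>, simultaneously for all sparse
  \<open>\<Gamma> \<subseteq> G\<close>: the boosters are disjoint from \<open>\<Gamma>\<close>, so the two events are independent, and there are few
  sparse \<open>\<Gamma>\<close>. As \<open>H\<close> contains at most \<open>|A| d / 6\<close> edges meeting \<open>A\<close>, a booster survives in \<open>G - H\<close>.
  Adding boosters at most \<open>n\<close> times keeps the subgraph sparse and produces a Hamilton cycle.
\<close>

section \<open>Rotations and boosters\<close>

fun path_edges :: "'a list \<Rightarrow> 'a set set" where
  "path_edges (x # y # zs) = insert {x, y} (path_edges (y # zs))"
| "path_edges _ = {}"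

lemma path_edges_Cons: "xs \<noteq> [] \<Longrightarrow> path_edges (x # xs) = insert {x, hd xs} (path_edges xs)"
  by (cases xs) auto

lemma path_edges_append:
  "xs \<noteq> [] \<Longrightarrow> ys \<noteq> [] \<Longrightarrow>
    path_edges (xs @ ys) = insert {last xs, hd ys} (path_edges xs \<union> path_edges ys)"
proof (induction xs)
  case (Cons x xs)
  then show ?case by (cases "xs = []") (auto simp: path_edges_Cons)
qed simp

lemma path_edges_rev: "path_edges (rev xs) = path_edges xs"
proof (induction xs)
  case (Cons x xs)
  then show ?case
    by (cases "xs = []") (auto simp: path_edges_Cons path_edges_append last_rev insert_commute)
qed simp

lemma path_edges_subset: "e \<in> path_edges xs \<Longrightarrow> e \<subseteq> set xs"
  by (induction xs rule: path_edges.induct) auto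

lemma path_edges_nth:
  "e \<in> path_edges xs \<Longrightarrow> \<exists>i. Suc i < length xs \<and> e = {xs ! i, xs ! Suc i}"
proof (induction xs rule: path_edges.induct)
  case (1 x y zs)
  show ?case
  proof (cases "e = {x, y}")
    case True
    then show ?thesis by (intro exI[of _ 0]) auto
  next
    case False
    with 1 obtain i where "Suc i < length (y # zs)" "e = {(y # zs) ! i, (y # zs) ! Suc i}"
      by auto
    then show ?thesis by (intro exI[of _ "Suc i"]) auto
  qed
qed auto

lemma nth_path_edges: "Suc i < length xs \<Longrightarrow> {xs ! i, xs ! Suc i} \<in> path_edges xs"
proof (induction xs arbitrary: i rule: path_edges.induct)
  case (1 x y zs)
  then show ?case by (cases i) auto
qed auto

text \<open>A vertex of a path is adjacent along it only to its predecessor and its successor. This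
  is the source of the factor 2 in Posa's lemma.\<close>

lemma card_path_neighbours:
  assumes "distinct xs"
  shows "finite {y. {y, z} \<in> path_edges xs}" "card {y. {y, z} \<in> path_edges xs} \<le> 2"
proof -
  have "\<exists>a b. {y. {y, z} \<in> path_edges xs} \<subseteq> {a, b}"
  proof (cases "z \<in> set xs")
    case False
    then have "{y. {y, z} \<in> path_edges xs} = {}"
      using path_edges_subset by fastforce
    then show ?thesis by simp
  next
    case True
    then obtain j where j: "j < length xs" "xs ! j = z"
      by (auto simp: in_set_conv_nth)
    \<comment> \<open>At an end of the list one of the two entries is spurious
      (\<open>j - 1 = 0\<close> for \<open>j = 0\<close>, or an index out of range). It can only
      enlarge the set, and only an upper bound is wanted.\<close>
    have "y \<in> {xs ! (j - 1), xs ! Suc j}" if "{y, z} \<in> path_edges xs" for y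
    proof -
      from path_edges_nth[OF that] obtain i where
        i: "Suc i < length xs" "{y, z} = {xs ! i, xs ! Suc i}" by blast
      then consider "y = xs ! i" "z = xs ! Suc i" | "y = xs ! Suc i" "z = xs ! i"
        by (auto simp: doubleton_eq_iff)
      then show ?thesis
      proof cases
        case 1
        then have "j = Suc i" using i j assms by (metis nth_eq_iff_index_eq)
        then show ?thesis using 1 by simp
      next
        case 2
        then have "j = i" using i j assms by (metis Suc_lessD nth_eq_iff_index_eq)
        then show ?thesis using 2 by simp
      qed
    qed
    then show ?thesis by blast
  qed
  then obtain a b where ab: "{y. {y, z} \<in> path_edges xs} \<subseteq> {a, b}" by blast
  show "finite {y. {y, z} \<in> path_edges xs}" using finite_subset[OF ab] by simp
  have "card {y. {y, z} \<in> path_edges xs} \<le> card {a, b}" by (rule card_mono[OF _ ab]) simp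
  also have "\<dots> \<le> 2" by (simp add: card_insert_if)
  finally show "card {y. {y, z} \<in> path_edges xs} \<le> 2" .
qed

definition graph_path :: "'a set \<Rightarrow> 'a set set \<Rightarrow> 'a list \<Rightarrow> bool" where
  "graph_path V E xs \<longleftrightarrow> xs \<noteq> [] \<and> distinct xs \<and> set xs \<subseteq> V \<and> path_edges xs \<subseteq> E"

definition longest_path :: "'a set \<Rightarrow> 'a set set \<Rightarrow> 'a list \<Rightarrow> bool" where
  "longest_path V E xs \<longleftrightarrow> graph_path V E xs \<and> (\<forall>ys. graph_path V E ys \<longrightarrow> length ys \<le> length xs)"

lemma path_length_le: "finite V \<Longrightarrow> graph_path V E xs \<Longrightarrow> length xs \<le> card V"
  unfolding graph_path_def by (metis card_mono distinct_card)

lemma path_rev: "graph_path V E xs \<Longrightarrow> graph_path V E (rev xs)"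
  by (simp add: graph_path_def path_edges_rev)

lemma longest_path_exists:
  assumes "finite V" "V \<noteq> {}"
  obtains xs where "longest_path V E xs"
proof -
  from assms obtain v where "v \<in> V" by blast
  then have "graph_path V E [v]" by (simp add: graph_path_def)
  moreover have "\<forall>ys. graph_path V E ys \<longrightarrow> length ys < Suc (card V)"
    using path_length_le[OF assms(1)] by (simp add: less_Suc_eq_le)
  ultimately obtain xs where "graph_path V E xs" "\<forall>ys. graph_path V E ys \<longrightarrow> length ys \<le> length xs"
    using ex_has_greatest_nat[of "graph_path V E" "[v]" length "Suc (card V)"] by (auto simp: less_imp_le)
  then show ?thesis using that by (auto simp: longest_path_def)
qed

lemma longest_path_neighbour:
  assumes "longest_path V E xs" "{last xs, y} \<in> E" "y \<in> V"
  shows "y \<in> set xs"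
proof (rule ccontr)
  assume "y \<notin> set xs"
  then have "graph_path V E (xs @ [y])"
    using assms by (auto simp: longest_path_def graph_path_def path_edges_append)
  then show False using assms(1) by (fastforce simp: longest_path_def)
qed

text \<open>Sequences of Posa rotations. One rotation replaces the path edge from \<open>y\<close>
  to \<open>hd ws\<close> by the edge of \<open>E\<close> from \<open>y\<close> to
  \<open>last ws\<close>; the first vertex stays fixed and \<open>hd ws\<close> becomes the new
  end.\<close>

inductive rotated :: "'a set set \<Rightarrow> 'a list \<Rightarrow> 'a list \<Rightarrow> bool" for E xs where
  base: "rotated E xs xs"
| step: "rotated E xs (us @ y # ws) \<Longrightarrow> ws \<noteq> [] \<Longrightarrow> {y, last ws} \<in> E \<Longrightarrow>
    rotated E xs (us @ y # rev ws)"

definition rotation_ends :: "'a set set \<Rightarrow> 'a list \<Rightarrow> 'a set" where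
  "rotation_ends E xs = {last zs |zs. rotated E xs zs}"

lemma rotation_endsI: "rotated E xs zs \<Longrightarrow> last zs \<in> rotation_ends E xs"
  by (auto simp: rotation_ends_def)

lemma path_edges_split:
  "ws \<noteq> [] \<Longrightarrow> path_edges (us @ y # ws) =
    insert {y, hd ws} (path_edges (us @ [y]) \<union> path_edges ws)"
  using path_edges_append[of "us @ [y]" ws] by simp

lemma rotated_path:
  assumes "rotated E xs zs" "graph_path V E xs"
  shows "graph_path V E zs \<and> set zs = set xs \<and> length zs = length xs \<and> hd zs = hd xs"
  using assms
proof induction
  case (step us y ws)
  then have p: "graph_path V E (us @ y # ws)" by blast
  have "path_edges (us @ y # rev ws) \<subseteq> E"
    using p step.hyps
    by (auto simp: graph_path_def path_edges_split path_edges_rev hd_rev)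
  moreover have "hd (us @ y # rev ws) = hd (us @ y # ws)" by (cases us) auto
  ultimately show ?case using step by (auto simp: graph_path_def)
qed auto

lemma rotated_longest_path:
  assumes "rotated E xs zs" "longest_path V E xs"
  shows "longest_path V E zs"
proof -
  have "graph_path V E xs" using assms(2) by (simp add: longest_path_def)
  from rotated_path[OF assms(1) this] have "graph_path V E zs" "length zs = length xs" by auto
  then show ?thesis using assms(2) by (simp add: longest_path_def)
qed

text \<open>
  No rotation ever breaks the path at such a vertex \<open>y\<close>: the deleted edge would still be an edge of
  the original path, and its other end becomes a rotation end.
\<close>

lemma rotated_edges_unchanged:
  assumes "rotated E xs zs" "y \<notin> rotation_ends E xs"
    "\<And>z. z \<in> rotation_ends E xs \<Longrightarrow> {y, z} \<notin> path_edges xs"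
  shows "{e \<in> path_edges zs. y \<in> e} = {e \<in> path_edges xs. y \<in> e}"
  using assms(1)
proof induction
  case (step us x ws)
  let ?z = "hd ws" and ?v = "last ws"
  have v: "?v \<in> rotation_ends E xs"
    using rotation_endsI[OF step.hyps(1)] step.hyps(2) by simp
  have z: "?z \<in> rotation_ends E xs"
    using rotation_endsI[OF rotated.step[OF step.hyps]] step.hyps(2) by (simp add: last_rev)
  have old: "path_edges (us @ x # ws) = insert {x, ?z} (path_edges (us @ [x]) \<union> path_edges ws)"
    using step.hyps by (simp add: path_edges_split)
  have new: "path_edges (us @ x # rev ws) = insert {x, ?v} (path_edges (us @ [x]) \<union> path_edges ws)"
    using step.hyps by (simp add: path_edges_split path_edges_rev hd_rev)
  have "x \<noteq> y"
  proof
    assume "x = y"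
    then have "{y, ?z} \<in> {e \<in> path_edges xs. y \<in> e}"
      using step.IH old by blast
    then show False using assms(3) z by blast
  qed
  moreover have "y \<noteq> ?z" "y \<noteq> ?v" using v z assms(2) by auto
  ultimately have "{e \<in> path_edges (us @ x # rev ws). y \<in> e} =
      {e \<in> path_edges (us @ x # ws). y \<in> e}"
    unfolding old new by auto
  then show ?case by (rule trans[OF _ step.IH])
qed simp

section \<open>Posa's lemma and expansion\<close>

definition nbhd :: "'a set set \<Rightarrow> 'a set \<Rightarrow> 'a set" where
  "nbhd E S = {y. y \<notin> S \<and> (\<exists>x\<in>S. {x, y} \<in> E)}"

text \<open>Posa's lemma. An outside neighbour \<open>y\<close> of an end lies on the corresponding
  longest path, and rotating there turns the successor of \<open>y\<close> into an end. If no
  neighbour of \<open>y\<close> along the original path were an end, the path edges at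
  \<open>y\<close> would never have changed, so that successor would be such a neighbour after
  all.\<close>

lemma posa_rotation:
  assumes "longest_path V E xs" "\<And>e. e \<in> E \<Longrightarrow> e \<subseteq> V"
  shows "nbhd E (rotation_ends E xs) \<subseteq> (\<Union>z\<in>rotation_ends E xs. {y. {y, z} \<in> path_edges xs})"
proof
  fix y assume y: "y \<in> nbhd E (rotation_ends E xs)"
  then obtain zs where zs: "rotated E xs zs" "{last zs, y} \<in> E"
    by (auto simp: nbhd_def rotation_ends_def)
  have lp: "longest_path V E zs" using rotated_longest_path zs(1) assms(1) by blast
  have "y \<in> set zs"
    by (rule longest_path_neighbour[OF lp zs(2)]) (use assms(2)[OF zs(2)] in auto)
  then obtain us ws where split: "zs = us @ y # ws" by (auto dest: split_list)
  have yR: "y \<notin> rotation_ends E xs" using y by (simp add: nbhd_def)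
  have ws: "ws \<noteq> []"
  proof
    assume "ws = []"
    then have "last zs = y" using split by simp
    then show False using yR zs(1) by (auto simp: rotation_ends_def)
  qed
  have "rotated E xs (us @ y # rev ws)"
    using zs split ws by (intro rotated.step) (auto simp: insert_commute)
  from rotation_endsI[OF this] have hd: "hd ws \<in> rotation_ends E xs"
    using ws by (simp add: last_rev)
  show "y \<in> (\<Union>z\<in>rotation_ends E xs. {y. {y, z} \<in> path_edges xs})"
  proof (rule ccontr)
    assume no: "\<not> ?thesis"
    then have "{e \<in> path_edges zs. y \<in> e} = {e \<in> path_edges xs. y \<in> e}"
      using rotated_edges_unchanged[OF zs(1) yR] by blast
    moreover have "{y, hd ws} \<in> path_edges zs" using split ws by (simp add: path_edges_split)
    ultimately show False using no hd by blast
  qed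
qed

text \<open>The factor 2 is what Posa's lemma can contradict: a set of rotation ends has at most two
  outside neighbours per end.\<close>

definition expander :: "'a set \<Rightarrow> 'a set set \<Rightarrow> bool" where
  "expander V E \<longleftrightarrow>
     (\<forall>S\<subseteq>V. S \<noteq> {} \<longrightarrow> 4 * card S \<le> card V \<longrightarrow> 2 * card S < card (nbhd E S))"

lemma nbhd_mono: "E \<subseteq> E' \<Longrightarrow> nbhd E S \<subseteq> nbhd E' S"
  by (auto simp: nbhd_def)

lemma nbhd_subset: "(\<And>e. e \<in> E \<Longrightarrow> e \<subseteq> V) \<Longrightarrow> nbhd E S \<subseteq> V"
  by (fastforce simp: nbhd_def)

lemma expander_mono:
  assumes "expander V E" "E \<subseteq> E'" "finite V" "\<And>e. e \<in> E' \<Longrightarrow> e \<subseteq> V"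
  shows "expander V E'"
proof -
  have "card (nbhd E S) \<le> card (nbhd E' S)" for S
    using nbhd_mono[OF assms(2)] nbhd_subset[OF assms(4)] assms(3)
    by (meson card_mono finite_subset)
  then show ?thesis using assms(1) unfolding expander_def by (meson order_less_le_trans)
qed

lemma rotation_ends_subset:
  assumes "graph_path V E xs"
  shows "rotation_ends E xs \<subseteq> set xs"
proof
  fix v assume "v \<in> rotation_ends E xs"
  then obtain zs where zs: "rotated E xs zs" "v = last zs" by (auto simp: rotation_ends_def)
  then show "v \<in> set xs" using rotated_path[OF zs(1) assms] by (auto simp: graph_path_def)
qed

lemma card_rotation_ends:
  assumes "longest_path V E xs" "\<And>e. e \<in> E \<Longrightarrow> e \<subseteq> V" "expander V E" "finite V"
  shows "card V < 4 * card (rotation_ends E xs)"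
proof (rule ccontr)
  assume a: "\<not> ?thesis"
  let ?R = "rotation_ends E xs"
  have path: "graph_path V E xs" using assms(1) by (simp add: longest_path_def)
  have sub: "?R \<subseteq> V" using rotation_ends_subset[OF path] path by (auto simp: graph_path_def)
  then have fin: "finite ?R" using assms(4) finite_subset by blast
  have "?R \<noteq> {}" using rotation_endsI[OF rotated.base] by blast
  moreover have "4 * card ?R \<le> card V" using a by simp
  ultimately have "2 * card ?R < card (nbhd E ?R)"
    using assms(3) sub unfolding expander_def by blast
  also have "\<dots> \<le> card (\<Union>z\<in>?R. {y. {y, z} \<in> path_edges xs})"
    using path fin card_path_neighbours
    by (intro card_mono posa_rotation[OF assms(1,2)]) (auto simp: graph_path_def)
  also have "\<dots> \<le> (\<Sum>z\<in>?R. card {y. {y, z} \<in> path_edges xs})"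
    by (rule card_UN_le[OF fin])
  also have "\<dots> \<le> (\<Sum>z\<in>?R. 2)"
    using path by (intro sum_mono card_path_neighbours) (auto simp: graph_path_def)
  finally show False by simp
qed

text \<open>If no edge left \<open>W\<close>, then \<open>W\<close> and its complement would both
  have empty neighbourhood, and one of them has at most half of the vertices. A suitable subset of
  that one would have all its neighbours inside it, too few for the expansion.\<close>

lemma expander_connected:
  assumes "expander V E" "finite V" "\<And>e. e \<in> E \<Longrightarrow> e \<subseteq> V" "12 \<le> card V"
    "W \<subseteq> V" "W \<noteq> {}" "W \<noteq> V"
  shows "\<exists>x\<in>W. \<exists>w\<in>V - W. {x, w} \<in> E"
proof (rule ccontr)
  assume no: "\<not> ?thesis"
  have small: False if S: "S \<subseteq> V" "S \<noteq> {}" "2 * card S \<le> card V" "nbhd E S = {}" for S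
  proof -
    \<comment> \<open>The truncation brings the subset into the range of the expansion. With
      \<open>12 \<le> card V\<close>, three times \<open>card V div 4\<close> is at least half of
      \<open>card V\<close>, despite the rounding.\<close>
    define k where "k = min (card S) (card V div 4)"
    have "k \<le> card S" by (simp add: k_def)
    from obtain_subset_with_card_n[OF this] obtain T where T: "T \<subseteq> S" "card T = k" by blast
    have finS: "finite S" using S assms(2) finite_subset by blast
    have "k > 0" using S finS assms(4) by (auto simp: k_def card_gt_0_iff)
    then have "T \<noteq> {}" using T by auto
    moreover have "4 * card T \<le> card V" using T by (auto simp: k_def)
    ultimately have "2 * k < card (nbhd E T)"
      using assms(1) subset_trans[OF T(1) S(1)] T(2) unfolding expander_def by blast
    also have "card (nbhd E T) \<le> card (S - T)"
      using S(4) T finS by (intro card_mono) (auto simp: nbhd_def)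
    also have "\<dots> = card S - k" using T finS by (simp add: card_Diff_subset finite_subset)
    finally have "3 * k < card S" by simp
    then show False using S(3) assms(4) by (auto simp: k_def min_def split: if_splits)
  qed
  have W: "nbhd E W = {}" "nbhd E (V - W) = {}"
  proof -
    have "y \<notin> nbhd E W" for y
      using no assms(3) by (auto simp: nbhd_def)
    then show "nbhd E W = {}" by blast
    have "y \<notin> nbhd E (V - W)" for y
    proof
      assume "y \<in> nbhd E (V - W)"
      then obtain x where x: "x \<in> V - W" "{y, x} \<in> E" "y \<notin> V - W"
        by (auto simp: nbhd_def insert_commute)
      then show False using no assms(3)[OF x(2)] by auto
    qed
    then show "nbhd E (V - W) = {}" by blast
  qed
  have "card V = card W + card (V - W)"
    using assms(2,5) by (simp add: card_Diff_subset card_mono finite_subset)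
  then consider "2 * card W \<le> card V" | "2 * card (V - W) \<le> card V" by linarith
  then show False
    using small[of W] small[of "V - W"] W assms(5-7) by cases auto
qed

section \<open>Boosters\<close>

lemma path_closing_edge_HAM:
  assumes "graph_path V E xs" "set xs = V" "3 \<le> card V" "{last xs, hd xs} \<in> E"
  shows "(V, E) \<in> HAM"
proof -
  have len: "length xs = card V" using assms by (metis graph_path_def distinct_card)
  have "{xs ! i, xs ! (Suc i mod length xs)} \<in> E" if "i < length xs" for i
  proof (cases "Suc i = length xs")
    case True
    then have "xs ! i = last xs" "xs ! 0 = hd xs"
      using assms(1) by (auto simp: last_conv_nth hd_conv_nth graph_path_def simp flip: True)
    then show ?thesis using True assms(4) by simp
  next
    case False
    then show ?thesis using that nth_path_edges[of i xs] assms(1) by (auto simp: graph_path_def)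
  qed
  then have "hamilton_cycle (V, E) xs"
    using assms len by (simp add: hamilton_cycle_def verts_def edges_def graph_path_def)
  then show ?thesis by (auto simp: HAM_def)
qed

text \<open>The closing edge makes the path a cycle. Opening the cycle at \<open>x\<close> and
  putting \<open>w\<close> in front of \<open>x\<close> gains one vertex.\<close>

lemma path_extend_cycle:
  assumes "graph_path V E xs" "{last xs, hd xs} \<in> E" "x \<in> set xs" "w \<in> V - set xs" "{x, w} \<in> E"
  shows "\<exists>ys. graph_path V E ys \<and> length ys = Suc (length xs)"
proof -
  obtain us ws where split: "xs = us @ x # ws" using assms(3) by (auto dest: split_list)
  have e: "path_edges us \<subseteq> E" "path_edges (x # ws) \<subseteq> E"
    using assms(1) path_edges_append[of us "x # ws"] split
    by (cases "us = []"; auto simp: graph_path_def)+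
  have "path_edges (w # (x # ws) @ us) \<subseteq> E"
  proof (cases "us = []")
    case True
    then show ?thesis using e assms(5) by (simp add: insert_commute)
  next
    case False
    then have "path_edges ((x # ws) @ us) = insert {last xs, hd xs} (path_edges (x # ws) \<union> path_edges us)"
      using split by (subst path_edges_append) auto
    then show ?thesis using e assms(2,5) by (simp add: insert_commute)
  qed
  then have "graph_path V E (w # (x # ws) @ us)"
    using assms(1,4) split by (auto simp: graph_path_def)
  then show ?thesis using split by (intro exI[of _ "w # (x # ws) @ us"]) auto
qed

text \<open>The first alternative is needed once a longest path already covers \<open>V\<close>,
  since no longer path can then appear.\<close>

definition booster :: "'a set \<Rightarrow> 'a set set \<Rightarrow> 'a set \<Rightarrow> bool" where
  "booster V E e \<longleftrightarrow> (V, insert e E) \<in> HAM \<or>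
     (\<exists>xs. graph_path V (insert e E) xs \<and> (\<forall>ys. graph_path V E ys \<longrightarrow> length ys < length xs))"

lemma path_mono: "graph_path V E xs \<Longrightarrow> E \<subseteq> E' \<Longrightarrow> graph_path V E' xs"
  by (auto simp: graph_path_def)

text \<open>Joining the ends closes a cycle. If it covers \<open>V\<close>, it is a Hamilton cycle;
  otherwise connectivity gives an edge leaving it, along which the cycle opens to a longer
  path.\<close>

lemma longest_path_ends_booster:
  assumes "longest_path V E xs" "expander V E" "finite V" "\<And>e. e \<in> E \<Longrightarrow> e \<subseteq> V" "12 \<le> card V"
  shows "booster V E {last xs, hd xs}"
proof -
  let ?E = "insert {last xs, hd xs} E"
  have p: "graph_path V E xs" using assms(1) by (simp add: longest_path_def)
  then have p': "graph_path V ?E xs" by (rule path_mono) auto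
  show ?thesis
  proof (cases "set xs = V")
    case True
    then have "(V, ?E) \<in> HAM" using path_closing_edge_HAM[OF p'] assms(5) by simp
    then show ?thesis by (simp add: booster_def)
  next
    case False
    obtain x w where "x \<in> set xs" "w \<in> V - set xs" "{x, w} \<in> E"
      using expander_connected[OF assms(2-5), of "set xs"] False p by (auto simp: graph_path_def)
    then obtain ys where "graph_path V ?E ys" "length ys = Suc (length xs)"
      using path_extend_cycle[OF p', of x w] by auto
    then show ?thesis using assms(1) unfolding booster_def longest_path_def
      by (auto simp: less_Suc_eq_le)
  qed
qed

text \<open>This keeps the boosters disjoint from the graph that they boost, on which the
  factorisation of the probability rests later.\<close>

lemma booster_not_edge:
  assumes "booster V E e" "(V, E) \<notin> HAM"
  shows "e \<notin> E"
proof
  assume "e \<in> E"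
  then have "insert e E = E" by blast
  then show False using assms by (auto simp: booster_def)
qed

text \<open>Take \<open>m\<close> rotation ends as \<open>A\<close>. For each \<open>a\<close> in
  \<open>A\<close> a reversed rotated path is a longest path starting at \<open>a\<close>; rotating
  it with \<open>a\<close> fixed yields more than a quarter of all vertices as ends
  \<open>b\<close>, and every \<open>{a, b}\<close> is a booster. Having all boosters meet a set of
  only \<open>m\<close> vertices limits how many of them a graph of bounded degree can
  delete.\<close>

lemma booster_family:
  assumes "finite V" "E \<subseteq> {e. e \<subseteq> V \<and> card e = 2}" "expander V E" "(V, E) \<notin> HAM" "12 \<le> card V"
    "4 * m \<le> card V"
  obtains A F where "A \<subseteq> V" "card A = m" "F \<subseteq> {e. e \<subseteq> V \<and> card e = 2}" "F \<inter> E = {}"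
    "\<And>e. e \<in> F \<Longrightarrow> booster V E e" "\<And>e. e \<in> F \<Longrightarrow> e \<inter> A \<noteq> {}"
    "real m * (real (card V) / 4 - real m) \<le> real (card F)"
proof -
  have sub: "\<And>e. e \<in> E \<Longrightarrow> e \<subseteq> V" using assms(2) by auto
  have "V \<noteq> {}" using assms(5) by auto
  from longest_path_exists[OF assms(1) this] obtain xs where xs: "longest_path V E xs" by blast
  have "m \<le> card (rotation_ends E xs)"
    using card_rotation_ends[OF xs sub assms(3,1)] assms(6) by linarith
  then obtain A where A: "A \<subseteq> rotation_ends E xs" "card A = m"
    using obtain_subset_with_card_n by metis
  have AV: "A \<subseteq> V"
    using A rotation_ends_subset[of V E xs] xs by (auto simp: longest_path_def graph_path_def)
  then have finA: "finite A" using assms(1) finite_subset by blast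
  have "\<exists>zs. longest_path V E zs \<and> hd zs = a" if a: "a \<in> A" for a
  proof -
    obtain zs where zs: "rotated E xs zs" "last zs = a"
      using a A by (auto simp: rotation_ends_def)
    then have "longest_path V E zs" using rotated_longest_path xs by blast
    then have "longest_path V E (rev zs)" by (simp add: longest_path_def path_rev)
    then show ?thesis using zs(2) by (intro exI[of _ "rev zs"]) (auto simp: hd_rev)
  qed
  then obtain Q where Q: "\<And>a. a \<in> A \<Longrightarrow> longest_path V E (Q a)" "\<And>a. a \<in> A \<Longrightarrow> hd (Q a) = a"
    by metis
  \<comment> \<open>Removing \<open>A\<close> costs at most \<open>m\<close> ends and makes each
    pair \<open>{a, b}\<close> arise once, with \<open>a\<close> and \<open>b\<close>
    distinct.\<close>
  define B where "B a = rotation_ends E (Q a) - A" for a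
  define F where "F = (\<lambda>(a, b). {a, b}) ` Sigma A B"
  have BV: "B a \<subseteq> V" if "a \<in> A" for a
    using rotation_ends_subset[of V E "Q a"] Q(1)[OF that]
    by (auto simp: B_def longest_path_def graph_path_def)
  have boost: "booster V E {a, b}" if ab: "a \<in> A" "b \<in> B a" for a b
  proof -
    obtain zs where zs: "rotated E (Q a) zs" "last zs = b"
      using ab by (auto simp: B_def rotation_ends_def)
    have "longest_path V E zs" using rotated_longest_path zs(1) Q(1) ab(1) by blast
    moreover have "hd zs = a"
      using rotated_path[OF zs(1), of V] Q ab(1) by (auto simp: longest_path_def)
    ultimately show ?thesis
      using longest_path_ends_booster[of V E zs] assms(1,3,5) sub zs(2) by (auto simp: insert_commute)
  qed
  have Bcard: "real (card V) / 4 - real m \<le> real (card (B a))" if a: "a \<in> A" for a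
  proof -
    have "card V < 4 * card (rotation_ends E (Q a))"
      using card_rotation_ends[OF Q(1)[OF a] sub assms(3,1)] by simp
    moreover
    have "card (rotation_ends E (Q a)) - card A \<le> card (B a)"
      unfolding B_def using finA by (rule diff_card_le_card_Diff)
    then have "card (rotation_ends E (Q a)) \<le> card (B a) + m" using A(2) by simp
    then have "4 * card (rotation_ends E (Q a)) \<le> 4 * (card (B a) + m)" by (rule mult_le_mono2)
    ultimately have "card V < 4 * (card (B a) + m)" by (rule order.strict_trans2)
    then have "real (card V) < real (4 * (card (B a) + m))" by (simp only: of_nat_less_iff)
    then show ?thesis by (simp add: field_simps)
  qed
  have inj: "inj_on (\<lambda>(a, b). {a, b}) (Sigma A B)"
    by (auto simp: inj_on_def B_def doubleton_eq_iff)
  have "card F = (\<Sum>a\<in>A. card (B a))"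
    unfolding F_def card_image[OF inj] using finA BV assms(1) finite_subset
    by (intro card_SigmaI) blast+
  moreover have "real m * (real (card V) / 4 - real m) \<le> (\<Sum>a\<in>A. real (card (B a)))"
    using sum_mono[of A "\<lambda>_. real (card V) / 4 - real m" "\<lambda>a. real (card (B a))"] Bcard A(2) by simp
  ultimately have cardF: "real m * (real (card V) / 4 - real m) \<le> real (card F)" by simp
  show ?thesis
  proof (rule that[OF AV A(2) _ _ _ _ cardF])
    show "F \<subseteq> {e. e \<subseteq> V \<and> card e = 2}"
    proof
      fix e assume "e \<in> F"
      then obtain a b where ab: "a \<in> A" "b \<in> B a" "e = {a, b}" by (auto simp: F_def)
      then have "a \<noteq> b" by (auto simp: B_def)
      then show "e \<in> {e. e \<subseteq> V \<and> card e = 2}" using ab AV BV[OF ab(1)] by auto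
    qed
    show "F \<inter> E = {}"
      using boost booster_not_edge[OF _ assms(4)] by (auto simp: F_def)
    show "booster V E e" if "e \<in> F" for e using that boost by (auto simp: F_def)
    show "e \<inter> A \<noteq> {}" if "e \<in> F" for e using that by (auto simp: F_def)
  qed
qed

lemma HAM_mono: "(V, E) \<in> HAM \<Longrightarrow> E \<subseteq> E' \<Longrightarrow> (V, E') \<in> HAM"
  using monotone_increasing_HAM[where 'a='a] unfolding monotone_increasing_def spanning_subgraph_def
  by (metis edges_def fst_conv snd_conv verts_def)

text \<open>Each added booster either finishes or lengthens the longest path, which cannot outgrow
  \<open>V\<close>.\<close>

lemma HAM_by_boosters:
  assumes "finite V" "V \<noteq> {}" "E \<subseteq> {e. e \<subseteq> V \<and> card e = 2}" "E0 \<subseteq> E" "expander V E0"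
    and step: "\<And>E'. E' \<subseteq> E \<Longrightarrow> expander V E' \<Longrightarrow> (V, E') \<notin> HAM \<Longrightarrow> card E' \<le> card E0 + card V \<Longrightarrow>
      \<exists>e\<in>E. booster V E' e"
  shows "(V, E) \<in> HAM"
proof (rule ccontr)
  assume no: "(V, E) \<notin> HAM"
  have finE: "finite E" using assms(1,3) by (rule_tac finite_subset[of _ "Pow V"]) auto
  \<comment> \<open>The state after \<open>j\<close> additions. For \<open>j = card V\<close> the
    path has more vertices than \<open>V\<close>, a contradiction.\<close>
  have "\<exists>E'. E' \<subseteq> E \<and> expander V E' \<and> card E' \<le> card E0 + j \<and> (\<exists>xs. graph_path V E' xs \<and> Suc j \<le> length xs)"
    if "j \<le> card V" for j
    using that
  proof (induction j)
    case 0
    obtain v where "v \<in> V" using assms(2) by blast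
    then show ?case using assms(4,5)
      by (intro exI[of _ E0] conjI exI[of _ "[v]"]) (auto simp: graph_path_def)
  next
    case (Suc j)
    then obtain E' xs where E': "E' \<subseteq> E" "expander V E'" "card E' \<le> card E0 + j"
      "graph_path V E' xs" "Suc j \<le> length xs" by auto
    have noE': "(V, E') \<notin> HAM" using no HAM_mono E'(1) by blast
    then obtain e where e: "e \<in> E" "booster V E' e" using step[OF E'(1,2)] E'(3) Suc.prems by auto
    have sub: "insert e E' \<subseteq> E" using e E' by blast
    then have "(V, insert e E') \<notin> HAM" using no HAM_mono by blast
    then obtain ys where ys: "graph_path V (insert e E') ys" "length xs < length ys"
      using e(2) E'(4) by (auto simp: booster_def)
    have "expander V (insert e E')"
      using sub assms(3) by (intro expander_mono[OF E'(2) _ assms(1)]) auto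
    moreover have "card (insert e E') \<le> card E0 + Suc j"
      using E'(3) card_insert_le_m1[of _ E' e] finite_subset[OF E'(1) finE] by (simp add: card_insert_if)
    ultimately show ?case using sub ys E'(5) by (intro exI[of _ "insert e E'"]) auto
  qed
  from this[of "card V"] obtain E' xs where "graph_path V E' xs" "Suc (card V) \<le> length xs" by auto
  then show False using path_length_le[OF assms(1)] by fastforce
qed

section \<open>Sparse expanders after deleting edges\<close>

lemma sum_card_swap:
  assumes "finite A" "finite B"
  shows "(\<Sum>a\<in>A. card {b\<in>B. R a b}) = (\<Sum>b\<in>B. card {a\<in>A. R a b})"
proof -
  have "(\<Sum>a\<in>A. card {b\<in>B. R a b}) = (\<Sum>a\<in>A. \<Sum>b | b \<in> B \<and> R a b. 1)" by simp
  also have "\<dots> = (\<Sum>b\<in>B. \<Sum>a | a \<in> A \<and> R a b. 1)"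
    by (rule sum.swap_restrict[OF assms])
  finally show ?thesis by simp
qed

text \<open>By double counting, some element of \<open>E\<close> lies in at least a \<rho>-fraction
  of the sets not yet hit. Adding it multiplies their number by at most 1 - \<rho>.\<close>

lemma greedy_hitting_set:
  fixes \<rho> :: real
  assumes "finite E" "finite \<F>" "E \<noteq> {}" "\<rho> \<le> 1"
    and big: "\<And>F. F \<in> \<F> \<Longrightarrow> F \<subseteq> E \<and> \<rho> * card E \<le> card F"
  shows "\<exists>X\<subseteq>E. card X \<le> t \<and> card {F\<in>\<F>. F \<inter> X = {}} \<le> (1 - \<rho>) ^ t * card \<F>"
proof (induction t)
  case 0
  show ?case by (intro exI[of _ "{}"]) simp
next
  case (Suc t)
  then obtain X where X: "X \<subseteq> E" "card X \<le> t" "card {F\<in>\<F>. F \<inter> X = {}} \<le> (1 - \<rho>) ^ t * card \<F>"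
    by blast
  define R where "R = {F\<in>\<F>. F \<inter> X = {}}"
  have finR: "finite R" using assms(2) by (simp add: R_def)
  have "\<exists>e\<in>E. \<rho> * card R \<le> card {F\<in>R. e \<in> F}"
  proof (rule ccontr)
    assume "\<not> ?thesis"
    then have "\<And>e. e \<in> E \<Longrightarrow> real (card {F\<in>R. e \<in> F}) < \<rho> * card R" by force
    then have "(\<Sum>e\<in>E. real (card {F\<in>R. e \<in> F})) < (\<Sum>e\<in>E. \<rho> * card R)"
      by (intro sum_strict_mono assms)
    also have "\<dots> = (\<Sum>F\<in>R. \<rho> * card E)" by simp
    also have "\<dots> \<le> (\<Sum>F\<in>R. real (card F))"
      using big by (intro sum_mono) (auto simp: R_def)
    also have "\<dots> = (\<Sum>F\<in>R. real (card {e\<in>E. e \<in> F}))"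
    proof (rule sum.cong[OF refl])
      fix F assume "F \<in> R"
      then have "{e\<in>E. e \<in> F} = F" using big by (auto simp: R_def)
      then show "real (card F) = real (card {e\<in>E. e \<in> F})" by simp
    qed
    also have "\<dots> = (\<Sum>e\<in>E. real (card {F\<in>R. e \<in> F}))"
      using sum_card_swap[OF assms(1) finR, of "(\<in>)"] by (simp flip: of_nat_sum)
    finally show False by simp
  qed
  then obtain e where e: "e \<in> E" "\<rho> * card R \<le> card {F\<in>R. e \<in> F}" by blast
  have eq: "{F\<in>\<F>. F \<inter> insert e X = {}} = R - {F\<in>R. e \<in> F}" by (auto simp: R_def)
  have "real (card {F\<in>\<F>. F \<inter> insert e X = {}}) = real (card R) - card {F\<in>R. e \<in> F}"
    unfolding eq using finR by (subst card_Diff_subset) (auto simp: card_mono of_nat_diff)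
  also have "\<dots> \<le> (1 - \<rho>) * card R" using e(2) by (simp add: algebra_simps)
  also have "\<dots> \<le> (1 - \<rho>) * ((1 - \<rho>) ^ t * card \<F>)"
    using X(3) assms(4) by (intro mult_left_mono) (auto simp: R_def)
  finally have "card {F\<in>\<F>. F \<inter> insert e X = {}} \<le> (1 - \<rho>) ^ Suc t * card \<F>"
    by (simp add: mult.assoc)
  moreover have "card (insert e X) \<le> Suc t"
    using X(2) card_insert_le_m1[of "Suc t" X e] by simp
  ultimately show ?case using X(1) e(1) by (intro exI[of _ "insert e X"]) auto
qed

lemma hitting_set:
  fixes \<rho> :: real
  assumes "finite E" "finite \<F>" "E \<noteq> {}" "0 \<le> \<rho>" "\<rho> \<le> 1"
    and "\<And>F. F \<in> \<F> \<Longrightarrow> F \<subseteq> E \<and> \<rho> * card E \<le> card F"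
    and "card \<F> * exp (- \<rho> * t) < 1"
  obtains X where "X \<subseteq> E" "card X \<le> t" "\<And>F. F \<in> \<F> \<Longrightarrow> F \<inter> X \<noteq> {}"
proof -
  obtain X where X: "X \<subseteq> E" "card X \<le> t" "card {F\<in>\<F>. F \<inter> X = {}} \<le> (1 - \<rho>) ^ t * card \<F>"
    using greedy_hitting_set[OF assms(1-3,5,6)] by blast
  have "(1 - \<rho>) ^ t \<le> exp (- \<rho>) ^ t"
    using assms(5) exp_ge_add_one_self[of "- \<rho>"] by (intro power_mono) auto
  also have "\<dots> = exp (- \<rho> * t)" by (simp add: exp_of_nat_mult[symmetric] mult.commute)
  finally have "(1 - \<rho>) ^ t * card \<F> \<le> exp (- \<rho> * t) * card \<F>" by (rule mult_right_mono) simp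
  then have "real (card {F\<in>\<F>. F \<inter> X = {}}) < 1" using X(3) assms(7) by (simp add: mult.commute)
  then have "{F\<in>\<F>. F \<inter> X = {}} = {}" using assms(2) by simp
  then show ?thesis using that[OF X(1,2)] by blast
qed

text \<open>\<open>E0\<close> consists of \<open>D\<close> edges at every vertex and a set hitting
  all large cuts. If \<open>S\<close> expands badly, let \<open>U\<close> be \<open>S\<close> with
  its neighbours, so \<open>card U \<le> 3 * card S\<close>. For small \<open>S\<close> the chosen
  edges at \<open>S\<close> all lie in \<open>U\<close>, at least \<open>D * card S / 2\<close> in
  number, too many for \<open>small\<close>. For large \<open>S\<close> no edge of \<open>E0\<close>
  joins \<open>S\<close> to the complement of \<open>U\<close>, although the hitting set contains
  such an edge.\<close>

lemma sparse_expander_subgraph: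
  fixes s \<rho> :: real
  assumes fin: "finite V" and E: "E \<subseteq> {e. e \<subseteq> V \<and> card e = 2}" "E \<noteq> {}" and \<rho>: "0 < \<rho>" "\<rho> \<le> 1"
    and deg: "\<And>v. v \<in> V \<Longrightarrow> D \<le> card {e\<in>E. v \<in> e}"
    and small: "\<And>U. U \<subseteq> V \<Longrightarrow> U \<noteq> {} \<Longrightarrow> card U \<le> 3 * s \<Longrightarrow> 6 * card {e\<in>E. e \<subseteq> U} < D * card U"
    and large: "\<And>S T. S \<subseteq> V \<Longrightarrow> T \<subseteq> V \<Longrightarrow> S \<inter> T = {} \<Longrightarrow> s < card S \<Longrightarrow> card V \<le> 4 * card T \<Longrightarrow>
      \<rho> * card E \<le> card {e\<in>E. e \<inter> S \<noteq> {} \<and> e \<inter> T \<noteq> {}}"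
    and t: "4 ^ card V * exp (- \<rho> * t) < 1"
  obtains E0 where "E0 \<subseteq> E" "expander V E0" "card E0 \<le> card V * D + t"
proof -
  have finE: "finite E" using E(1) fin by (rule_tac finite_subset[of _ "Pow V"]) auto
  have "\<exists>Ev\<subseteq>{e\<in>E. v \<in> e}. card Ev = D" if "v \<in> V" for v
    using obtain_subset_with_card_n[OF deg[OF that]] by metis
  then obtain N where N: "\<And>v. v \<in> V \<Longrightarrow> N v \<subseteq> {e\<in>E. v \<in> e} \<and> card (N v) = D" by metis
  define E1 where "E1 = (\<Union>v\<in>V. N v)"
  have E1: "E1 \<subseteq> E" using N by (auto simp: E1_def)
  have "card E1 \<le> (\<Sum>v\<in>V. card (N v))" unfolding E1_def by (rule card_UN_le[OF fin])
  also have "\<dots> = card V * D" using N by simp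
  finally have cardE1: "card E1 \<le> card V * D" .
  define I where "I = {(S, T). S \<subseteq> V \<and> T \<subseteq> V \<and> S \<inter> T = {} \<and> s < card S \<and> card V \<le> 4 * card T}"
  define \<F> where "\<F> = (\<lambda>(S, T). {e\<in>E. e \<inter> S \<noteq> {} \<and> e \<inter> T \<noteq> {}}) ` I"
  have I: "I \<subseteq> Pow V \<times> Pow V" by (auto simp: I_def)
  then have finI: "finite I" using fin by (auto intro: finite_subset)
  have "card \<F> \<le> card I" unfolding \<F>_def by (rule card_image_le[OF finI])
  also have "\<dots> \<le> card (Pow V \<times> Pow V)" using fin by (intro card_mono[OF _ I]) auto
  also have "\<dots> = 4 ^ card V"
    using fin by (simp add: card_cartesian_product card_Pow power_mult_distrib[symmetric])
  finally have "real (card \<F>) \<le> real (4 ^ card V)" by (rule of_nat_mono)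
  then have "real (card \<F>) \<le> 4 ^ card V" by simp
  then have "card \<F> * exp (- \<rho> * t) \<le> 4 ^ card V * exp (- \<rho> * t)" by (rule mult_right_mono) simp
  then have "card \<F> * exp (- \<rho> * t) < 1" using t by linarith
  moreover have "F \<subseteq> E \<and> \<rho> * card E \<le> card F" if "F \<in> \<F>" for F
    using that large by (auto simp: \<F>_def I_def)
  moreover have "finite \<F>" unfolding \<F>_def using finI by simp
  ultimately obtain X where X: "X \<subseteq> E" "card X \<le> t" "\<And>F. F \<in> \<F> \<Longrightarrow> F \<inter> X \<noteq> {}"
    using hitting_set[OF finE _ E(2), of \<F> \<rho> t] \<rho> by (metis less_eq_real_def)
  define E0 where "E0 = E1 \<union> X"
  have E0: "E0 \<subseteq> E" using E1 X by (auto simp: E0_def)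
  have finE0: "finite E0" using E0 finE finite_subset by blast
  have pairs: "\<exists>x y. e = {x, y} \<and> x \<noteq> y \<and> x \<in> V \<and> y \<in> V" if "e \<in> E0" for e
  proof -
    have "e \<subseteq> V" "card e = 2" using that E0 E(1) by auto
    then show ?thesis by (auto simp: card_2_iff)
  qed
  have "card (nbhd E0 S) > 2 * card S" if S: "S \<subseteq> V" "S \<noteq> {}" "4 * card S \<le> card V" for S
  proof (rule ccontr)
    assume few: "\<not> ?thesis"
    define U where "U = S \<union> nbhd E0 S"
    have UV: "U \<subseteq> V" using S(1) nbhd_subset[of E0 V S] E0 E(1) by (auto simp: U_def)
    have cardU: "card U \<le> 3 * card S"
      unfolding U_def using card_Un_le[of S "nbhd E0 S"] few by linarith
    have U: "e \<subseteq> U" if "e \<in> E0" "e \<inter> S \<noteq> {}" for e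
    proof -
      obtain x where x: "x \<in> e" "x \<in> S" using \<open>e \<inter> S \<noteq> {}\<close> by blast
      then obtain y where "e = {x, y}"
        using pairs[OF \<open>e \<in> E0\<close>] by (metis insert_commute insertE singletonD)
      then show ?thesis using x \<open>e \<in> E0\<close> by (auto simp: U_def nbhd_def)
    qed
    have finS: "finite S" using S(1) fin finite_subset by blast
    show False
    proof (cases "card S \<le> s")
      case True
      let ?EU = "{e\<in>E0. e \<subseteq> U}"
      have finEU: "finite ?EU" using finE0 by simp
      have "D * card S = (\<Sum>v\<in>S. D)" by simp
      also have "\<dots> \<le> (\<Sum>v\<in>S. card {e\<in>?EU. v \<in> e})"
      proof (rule sum_mono)
        fix v assume v: "v \<in> S"
        then have vV: "v \<in> V" using S(1) by blast
        then have "N v \<subseteq> {e\<in>?EU. v \<in> e}"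
          using N[OF vV] U v by (auto simp: E0_def E1_def)
        then have "card (N v) \<le> card {e\<in>?EU. v \<in> e}" using finE0 by (intro card_mono) auto
        then show "D \<le> card {e\<in>?EU. v \<in> e}" using N[OF vV] by simp
      qed
      also have "\<dots> = (\<Sum>e\<in>?EU. card {v\<in>S. v \<in> e})" by (rule sum_card_swap[OF finS finEU])
      also have "\<dots> \<le> (\<Sum>e\<in>?EU. 2)"
      proof (rule sum_mono)
        fix e assume "e \<in> ?EU"
        then have "card e = 2" using E0 E(1) by auto
        moreover from this have "finite e" by (metis card.infinite zero_neq_numeral)
        then have "card {v\<in>S. v \<in> e} \<le> card e" by (intro card_mono) auto
        ultimately show "card {v\<in>S. v \<in> e} \<le> 2" by simp
      qed
      finally have le: "D * card S \<le> 2 * card ?EU" by simp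
      have "real (card U) \<le> 3 * s" using cardU True by linarith
      moreover have "U \<noteq> {}" using S(2) by (auto simp: U_def)
      ultimately have "6 * card {e\<in>E. e \<subseteq> U} < D * card U" using small UV by blast
      also have "\<dots> \<le> D * (3 * card S)" using cardU by (rule mult_le_mono2)
      also have "\<dots> \<le> 6 * card ?EU" using le by simp
      also have "\<dots> \<le> 6 * card {e\<in>E. e \<subseteq> U}"
        using E0 finE by (intro mult_le_mono2 card_mono) auto
      finally show False by simp
    next
      case False
      define T where "T = V - U"
      \<comment> \<open>Here \<open>card U \<le> 3 * card S\<close> is at most three quarters of
        \<open>card V\<close>, so \<open>T\<close> keeps the remaining quarter.\<close>
      have "card T = card V - card U"
        unfolding T_def using UV fin by (intro card_Diff_subset) (auto intro: finite_subset)
      then have "card V \<le> 4 * card T" using cardU S(3) by linarith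
      then have "(S, T) \<in> I" using False S(1) by (auto simp: I_def T_def U_def)
      then have "{e\<in>E. e \<inter> S \<noteq> {} \<and> e \<inter> T \<noteq> {}} \<in> \<F>" by (auto simp: \<F>_def)
      then obtain e where "e \<in> X" "e \<inter> S \<noteq> {}" "e \<inter> T \<noteq> {}" using X(3) by blast
      then show False using U[of e] by (auto simp: E0_def T_def)
    qed
  qed
  then have "expander V E0" unfolding expander_def by blast
  moreover have "card E0 \<le> card V * D + t"
    unfolding E0_def using card_Un_le[of E1 X] cardE1 X(2) by linarith
  ultimately show ?thesis using that E0 by blast
qed

lemma card_edges_meeting_le:
  fixes \<Delta> :: real
  assumes "finite A" "finite H" "\<And>v. v \<in> A \<Longrightarrow> card {e\<in>H. v \<in> e} \<le> \<Delta>"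
  shows "card {e\<in>H. e \<inter> A \<noteq> {}} \<le> card A * \<Delta>"
proof -
  have "{e\<in>H. e \<inter> A \<noteq> {}} = (\<Union>v\<in>A. {e\<in>H. v \<in> e})" by auto
  then have "card {e\<in>H. e \<inter> A \<noteq> {}} \<le> (\<Sum>v\<in>A. card {e\<in>H. v \<in> e})"
    using card_UN_le[OF assms(1)] by simp
  then have "real (card {e\<in>H. e \<inter> A \<noteq> {}}) \<le> real (\<Sum>v\<in>A. card {e\<in>H. v \<in> e})"
    by (rule of_nat_mono)
  also have "\<dots> \<le> (\<Sum>v\<in>A. \<Delta>)" unfolding of_nat_sum using assms(3) by (rule sum_mono)
  finally show ?thesis by simp
qed

text \<open>
  The hypothesis \<open>boosters\<close> speaks only about sparse subgraphs of the undeleted graph \<open>E\<close>, never about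
  \<open>H\<close>: this is what makes a union bound over all of its instances affordable.
\<close>

lemma HAM_after_deletion:
  fixes s \<rho> \<Delta> :: real
  assumes fin: "finite V" "V \<noteq> {}" and E: "E \<subseteq> {e. e \<subseteq> V \<and> card e = 2}"
    and H: "H \<subseteq> E" "\<And>v. v \<in> V \<Longrightarrow> card {e\<in>H. v \<in> e} \<le> \<Delta>"
    and \<rho>: "0 < \<rho>" "\<rho> \<le> 1" and D: "D > 0"
    and deg: "\<And>v. v \<in> V \<Longrightarrow> D + \<Delta> \<le> card {e\<in>E. v \<in> e}"
    and small: "\<And>U. U \<subseteq> V \<Longrightarrow> U \<noteq> {} \<Longrightarrow> card U \<le> 3 * s \<Longrightarrow> 6 * card {e\<in>E. e \<subseteq> U} < D * card U"
    and large: "\<And>S T. S \<subseteq> V \<Longrightarrow> T \<subseteq> V \<Longrightarrow> S \<inter> T = {} \<Longrightarrow> s < card S \<Longrightarrow> card V \<le> 4 * card T \<Longrightarrow>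
      \<rho> * card E + card S * \<Delta> \<le> card {e\<in>E. e \<inter> S \<noteq> {} \<and> e \<inter> T \<noteq> {}}"
    and t: "4 ^ card V * exp (- \<rho> * t) < 1"
    and boosters: "\<And>E'. E' \<subseteq> E \<Longrightarrow> expander V E' \<Longrightarrow> (V, E') \<notin> HAM \<Longrightarrow>
      card E' \<le> card V * D + t + card V \<Longrightarrow>
      \<exists>A F. A \<subseteq> V \<and> (\<forall>e\<in>F. booster V E' e \<and> e \<inter> A \<noteq> {}) \<and> card A * \<Delta> < card (F \<inter> E)"
  shows "(V, E - H) \<in> HAM"
proof -
  have finE: "finite E" using E(1) fin by (rule_tac finite_subset[of _ "Pow V"]) auto
  have finH: "finite H" using H(1) finE finite_subset by blast
  have Hmeet: "real (card {e\<in>H. e \<inter> A \<noteq> {}}) \<le> card A * \<Delta>" if "A \<subseteq> V" for A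
    using that H(2) fin(1) by (intro card_edges_meeting_le finH) (auto intro: finite_subset)
  have diff: "real (card {e\<in>E. P e}) - real (card {e\<in>H. P e}) = real (card {e\<in>E - H. P e})" for P
  proof -
    have "{e\<in>E - H. P e} = {e\<in>E. P e} - {e\<in>H. P e}" by auto
    moreover have "card ({e\<in>E. P e} - {e\<in>H. P e}) = card {e\<in>E. P e} - card {e\<in>H. P e}"
      using H(1) finH by (intro card_Diff_subset) auto
    moreover have "card {e\<in>H. P e} \<le> card {e\<in>E. P e}" using H(1) finE by (intro card_mono) auto
    ultimately show ?thesis by (simp add: of_nat_diff)
  qed
  have deg': "D \<le> card {e\<in>E - H. v \<in> e}" if "v \<in> V" for v
  proof -
    have "real D \<le> real (card {e\<in>E - H. v \<in> e})"
      using deg[OF that] H(2)[OF that] diff[of "\<lambda>e. v \<in> e"] by linarith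
    then show ?thesis by simp
  qed
  obtain E0 where E0: "E0 \<subseteq> E - H" "expander V E0" "card E0 \<le> card V * D + t"
  proof (rule sparse_expander_subgraph[OF fin(1) _ _ \<rho> deg' _ _ t])
    show "E - H \<subseteq> {e. e \<subseteq> V \<and> card e = 2}" using E by blast
    show "E - H \<noteq> {}"
    proof
      assume empty: "E - H = {}"
      from fin(2) obtain v where "v \<in> V" by blast
      with deg'[OF this] D empty show False by simp
    qed
    show "6 * card {e\<in>E - H. e \<subseteq> U} < D * card U"
      if "U \<subseteq> V" "U \<noteq> {}" "card U \<le> 3 * s" for U
    proof -
      have "card {e\<in>E - H. e \<subseteq> U} \<le> card {e\<in>E. e \<subseteq> U}" using finE by (intro card_mono) auto
      then show ?thesis using small[OF that] by linarith
    qed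
    show "\<rho> * card (E - H) \<le> card {e\<in>E - H. e \<inter> S \<noteq> {} \<and> e \<inter> T \<noteq> {}}"
      if ST: "S \<subseteq> V" "T \<subseteq> V" "S \<inter> T = {}" "s < card S" "card V \<le> 4 * card T" for S T
    proof -
      have "card {e\<in>H. e \<inter> S \<noteq> {} \<and> e \<inter> T \<noteq> {}} \<le> card {e\<in>H. e \<inter> S \<noteq> {}}"
        using finH by (intro card_mono) auto
      then have "real (card {e\<in>H. e \<inter> S \<noteq> {} \<and> e \<inter> T \<noteq> {}}) \<le> card S * \<Delta>"
        using Hmeet[OF ST(1)] by linarith
      moreover have "\<rho> * card (E - H) \<le> \<rho> * card E"
        using \<rho>(1) finE by (intro mult_left_mono) (auto intro: card_mono)
      ultimately show ?thesis
        using large[OF ST] diff[of "\<lambda>e. e \<inter> S \<noteq> {} \<and> e \<inter> T \<noteq> {}"] by linarith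
    qed
  qed
  show ?thesis
  proof (rule HAM_by_boosters[OF fin _ E0(1,2)])
    show "E - H \<subseteq> {e. e \<subseteq> V \<and> card e = 2}" using E by blast
    fix E' assume E': "E' \<subseteq> E - H" "expander V E'" "(V, E') \<notin> HAM" "card E' \<le> card E0 + card V"
    then obtain A F where AF: "A \<subseteq> V" "\<forall>e\<in>F. booster V E' e \<and> e \<inter> A \<noteq> {}"
      "card A * \<Delta> < card (F \<inter> E)"
      using boosters[of E'] E0(3) by force
    show "\<exists>e\<in>E - H. booster V E' e"
    proof (rule ccontr)
      assume "\<not> ?thesis"
      \<comment> \<open>If no booster survived, all those of \<open>F\<close> in \<open>E\<close>
        would be deleted edges at \<open>A\<close>, more than the degree bound on \<open>H\<close>
        allows.\<close>
      then have "F \<inter> E \<subseteq> {e\<in>H. e \<inter> A \<noteq> {}}" using AF(2) by blast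
      then have "card (F \<inter> E) \<le> card {e\<in>H. e \<inter> A \<noteq> {}}" using finH by (intro card_mono) auto
      then show False using Hmeet[OF AF(1)] AF(3) by linarith
    qed
  qed
qed

section \<open>Random subsets of a finite set\<close>

definition random_subset :: "'a set \<Rightarrow> real \<Rightarrow> 'a set pmf" where
  "random_subset A p = map_pmf (\<lambda>X. {e \<in> A. X e}) (Pi_pmf A False (\<lambda>_. bernoulli_pmf p))"

lemma binomial_random_graph_eq:
  "binomial_random_graph n p = map_pmf (Pair {1..n}) (random_subset (vertex_pairs n) p)"
  by (simp add: binomial_random_graph_def random_subset_def pmf.map_comp o_def)

lemma set_random_subset: "set_pmf (random_subset A p) \<subseteq> Pow A"
  by (auto simp: random_subset_def)

lemma expectation_random_subset_prod:
  fixes g h :: "'a \<Rightarrow> real"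
  assumes "finite A" "0 \<le> p" "p \<le> 1" "\<And>e. 0 \<le> g e" "\<And>e. 0 \<le> h e"
  shows "measure_pmf.expectation (random_subset A p) (\<lambda>E. \<Prod>e\<in>A. if e \<in> E then g e else h e) =
    (\<Prod>e\<in>A. p * g e + (1 - p) * h e)"
proof -
  have "measure_pmf.expectation (random_subset A p) (\<lambda>E. \<Prod>e\<in>A. if e \<in> E then g e else h e) =
    measure_pmf.expectation (Pi_pmf A False (\<lambda>_. bernoulli_pmf p))
      (\<lambda>X. \<Prod>e\<in>A. if X e then g e else h e)"
    unfolding random_subset_def integral_map_pmf by (intro Bochner_Integration.integral_cong refl prod.cong) auto
  also have "\<dots> = (\<Prod>e\<in>A. measure_pmf.expectation (bernoulli_pmf p) (\<lambda>b. if b then g e else h e))"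
    using assms by (intro expectation_prod_Pi_pmf) (auto intro!: integrable_measure_pmf_finite)
  also have "\<dots> = (\<Prod>e\<in>A. p * g e + (1 - p) * h e)"
    using assms by (simp add: mult.commute)
  finally show ?thesis .
qed

text \<open>The exponential moment method, with \<theta> of either sign so that it serves both
  tails. Since \<open>F\<close> and \<Gamma> are disjoint, the requirement that \<Gamma> be
  contained in the random set contributes an independent factor
  \<open>p ^ card \<Gamma>\<close>.\<close>

lemma prob_random_subset_le:
  fixes \<theta> a :: real
  assumes "finite A" "0 \<le> p" "p \<le> 1" "\<Gamma> \<subseteq> A" "F \<subseteq> A" "F \<inter> \<Gamma> = {}"
  shows "measure_pmf.prob (random_subset A p) {E. \<Gamma> \<subseteq> E \<and> \<theta> * a \<le> \<theta> * card (F \<inter> E)} \<le>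
    p ^ card \<Gamma> * exp (p * card F * (exp \<theta> - 1) - \<theta> * a)"
proof -
  let ?M = "random_subset A p"
  let ?S = "{E. \<Gamma> \<subseteq> E \<and> \<theta> * a \<le> \<theta> * card (F \<inter> E)}"
  \<comment> \<open>The product of \<open>g\<close> over the chosen elements gives the exponential
    moment; the product of \<open>h\<close> over the others is the indicator that none of them lies
    in \<Gamma>.\<close>
  define g where "g e = (if e \<in> F then exp \<theta> else 1)" for e
  define h :: "'a \<Rightarrow> real" where "h e = (if e \<in> \<Gamma> then 0 else 1)" for e
  let ?f = "\<lambda>E. exp (- \<theta> * a) * (\<Prod>e\<in>A. if e \<in> E then g e else h e)"
  have nonneg: "0 \<le> ?f E" for E
    by (intro mult_nonneg_nonneg prod_nonneg) (auto simp: g_def h_def)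
  have fin: "finite (set_pmf ?M)" using set_random_subset assms(1) by (meson finite_Pow_iff finite_subset)
  have "measure_pmf.prob ?M ?S = measure_pmf.expectation ?M (indicator ?S)" by simp
  also have "\<dots> \<le> measure_pmf.expectation ?M ?f"
  proof (intro integral_mono_AE integrable_measure_pmf_finite fin AE_pmfI)
    fix E assume "E \<in> set_pmf ?M"
    then have EA: "E \<subseteq> A" using set_random_subset by blast
    show "indicator ?S E \<le> ?f E"
    proof (cases "E \<in> ?S")
      case True
      then have "(\<Prod>e\<in>A. if e \<in> E then g e else h e) = (\<Prod>e\<in>A. if e \<in> F \<inter> E then exp \<theta> else 1)"
        by (intro prod.cong) (auto simp: g_def h_def)
      also have "\<dots> = (\<Prod>e\<in>F \<inter> E. exp \<theta>)"
        using assms(1) EA by (subst prod.inter_restrict[symmetric]) (auto simp: Int_absorb1 Int_absorb2 le_infI2)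
      also have "\<dots> = exp (\<theta> * card (F \<inter> E))" by (simp add: exp_of_nat_mult[symmetric] mult.commute)
      finally have "?f E = exp (\<theta> * card (F \<inter> E) - \<theta> * a)" by (simp add: exp_diff exp_minus field_simps)
      also have "\<dots> \<ge> 1" using True by simp
      finally show ?thesis using True by simp
    qed (use nonneg in simp)
  qed
  also have "\<dots> = exp (- \<theta> * a) * (\<Prod>e\<in>A. p * g e + (1 - p) * h e)"
    using assms(1-3) by (simp add: expectation_random_subset_prod g_def h_def)
  also have "(\<Prod>e\<in>A. p * g e + (1 - p) * h e) =
      (\<Prod>e\<in>A. (if e \<in> \<Gamma> then p else 1) * (if e \<in> F then p * exp \<theta> + (1 - p) else 1))"
    using assms(6) by (intro prod.cong) (auto simp: g_def h_def)
  also have "\<dots> = (\<Prod>e\<in>\<Gamma>. p) * (\<Prod>e\<in>F. p * exp \<theta> + (1 - p))"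
    unfolding prod.distrib using assms(1,4,5)
    by (simp add: prod.inter_restrict[symmetric] Int_absorb1)
  also have "\<dots> = p ^ card \<Gamma> * (1 + p * (exp \<theta> - 1)) ^ card F" by (simp add: algebra_simps)
  also have "\<dots> \<le> p ^ card \<Gamma> * exp (p * (exp \<theta> - 1)) ^ card F"
  proof -
    have "0 \<le> p * exp \<theta> + (1 - p)" using assms(2,3) by simp
    then have "0 \<le> 1 + p * (exp \<theta> - 1)" by (simp add: algebra_simps)
    then show ?thesis using assms(2) by (intro mult_left_mono power_mono) auto
  qed
  also have "exp (p * (exp \<theta> - 1)) ^ card F = exp (p * card F * (exp \<theta> - 1))"
    by (simp add: exp_of_nat_mult[symmetric] algebra_simps)
  also have "exp (- \<theta> * a) * (p ^ card \<Gamma> * exp (p * card F * (exp \<theta> - 1))) =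
      p ^ card \<Gamma> * (exp (p * card F * (exp \<theta> - 1)) * exp (- \<theta> * a))" by simp
  also have "\<dots> = p ^ card \<Gamma> * exp (p * card F * (exp \<theta> - 1) - \<theta> * a)"
    unfolding mult_exp_exp by simp
  finally show ?thesis by simp
qed

text \<open>Take \<theta> = -1/5. From exp(-1/5) \<le> 0.82 the exponent is at most (-0.18 + 0.16)
  times the mean, which is -1/50 of it.\<close>

lemma prob_random_subset_lower_tail:
  fixes p :: real
  assumes "finite A" "0 \<le> p" "p \<le> 1" "\<Gamma> \<subseteq> A" "F \<subseteq> A" "F \<inter> \<Gamma> = {}"
  shows "measure_pmf.prob (random_subset A p) {E. \<Gamma> \<subseteq> E \<and> card (F \<inter> E) \<le> 4/5 * p * card F} \<le>
    p ^ card \<Gamma> * exp (- p * card F / 50)"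
proof -
  have "(122/100 :: real) \<le> exp (1/5)"
    using exp_lower_Taylor_quadratic[of "1/5"] by (simp add: power2_eq_square)
  then have "exp (- (1/5)) \<le> (82/100 :: real)" by (simp add: exp_minus field_simps)
  then have "p * card F * (exp (- (1/5)) - 1) \<le> p * card F * (- (18/100))"
    using assms(2) by (intro mult_left_mono) auto
  then have e: "p * card F * (exp (- (1/5)) - 1) - (- (1/5)) * (4/5 * p * card F) \<le> - p * card F / 50"
    by (simp add: algebra_simps)
  have eq: "{E. \<Gamma> \<subseteq> E \<and> card (F \<inter> E) \<le> c} =
      {E. \<Gamma> \<subseteq> E \<and> (- (1/5)) * c \<le> (- (1/5)) * card (F \<inter> E)}" for c :: real by auto
  have "measure_pmf.prob (random_subset A p) {E. \<Gamma> \<subseteq> E \<and> card (F \<inter> E) \<le> 4/5 * p * card F} \<le>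
    p ^ card \<Gamma> * exp (p * card F * (exp (- (1/5)) - 1) - (- (1/5)) * (4/5 * p * card F))"
    unfolding eq by (rule prob_random_subset_le[OF assms])
  also have "\<dots> \<le> p ^ card \<Gamma> * exp (- p * card F / 50)"
    using e assms(2) by (intro mult_left_mono) auto
  finally show ?thesis .
qed

lemma prob_random_subset_few:
  fixes p :: real
  assumes "finite A" "0 \<le> p" "p \<le> 1" "F \<subseteq> A"
  shows "measure_pmf.prob (random_subset A p) {E. card (F \<inter> E) \<le> 4/5 * p * card F} \<le>
    exp (- p * card F / 50)"
  using prob_random_subset_lower_tail[OF assms(1-3) empty_subsetI assms(4) Int_empty_right]
  by (simp only: simp_thms empty_subsetI card.empty power_0 mult_1)

text \<open>Take \<theta> = 1, with e - 1 < 1.72.\<close>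

lemma prob_random_subset_upper_tail:
  fixes p a :: real
  assumes "finite A" "0 \<le> p" "p \<le> 1" "F \<subseteq> A"
  shows "measure_pmf.prob (random_subset A p) {E. a \<le> card (F \<inter> E)} \<le>
    exp (172/100 * p * card F - a)"
proof -
  have "p * card F * (exp 1 - 1) \<le> p * card F * (172/100)"
    using assms(2) e_less_272 by (intro mult_left_mono) auto
  then have "exp (p * card F * (exp 1 - 1) - a) \<le> exp (172/100 * p * card F - a)"
    by (simp add: algebra_simps)
  moreover have "measure_pmf.prob (random_subset A p) {E. a \<le> card (F \<inter> E)} \<le>
      exp (p * card F * (exp 1 - 1) - a)"
    using prob_random_subset_le[OF assms(1-3) _ assms(4), of "{}" 1 a] by simp
  ultimately show ?thesis by linarith
qed

lemma prob_UN_le: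
  assumes "finite I" "\<And>i. i \<in> I \<Longrightarrow> measure_pmf.prob M (B i) \<le> f i"
  shows "measure_pmf.prob M (\<Union>i\<in>I. B i) \<le> sum f I"
proof -
  have "measure_pmf.prob M (\<Union>i\<in>I. B i) \<le> (\<Sum>i\<in>I. measure_pmf.prob M (B i))"
    using assms(1) by (intro measure_pmf.finite_measure_subadditive_finite) auto
  also have "\<dots> \<le> sum f I" using assms(2) by (rule sum_mono)
  finally show ?thesis .
qed

lemma sum_Pow_power_card:
  fixes x :: real
  assumes "finite A"
  shows "(\<Sum>X\<in>Pow A. x ^ card X) = (1 + x) ^ card A"
  using prod_add[OF assms, of "\<lambda>_. x" "\<lambda>_. 1"] by (simp add: add.commute)

section \<open>Union bounds for the random graph\<close>

abbreviation pairs :: "'a set \<Rightarrow> 'a set set" where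
  "pairs V \<equiv> {e. e \<subseteq> V \<and> card e = 2}"

lemma finite_pairs: "finite V \<Longrightarrow> finite (pairs V)"
  by (rule finite_subset[of _ "Pow V"]) auto

lemma card_pairs_le: "finite V \<Longrightarrow> real (card (pairs V)) \<le> card V * card V / 2"
proof -
  assume "finite V"
  then have "2 * card (pairs V) \<le> card V * (card V - 1)"
    unfolding n_subsets[OF \<open>finite V\<close>] choose_two by (rule_tac times_div_less_eq_dividend)
  also have "\<dots> \<le> card V * card V" by simp
  finally have "real (2 * card (pairs V)) \<le> real (card V * card V)" by (rule of_nat_mono)
  then show ?thesis by simp
qed

lemma card_pairs_at:
  assumes "finite V" "v \<in> V"
  shows "card {e \<in> pairs V. v \<in> e} = card V - 1"
proof -
  have "{e \<in> pairs V. v \<in> e} = (\<lambda>w. {v, w}) ` (V - {v})"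
  proof
    show "{e \<in> pairs V. v \<in> e} \<subseteq> (\<lambda>w. {v, w}) ` (V - {v})"
    proof
      fix e assume "e \<in> {e \<in> pairs V. v \<in> e}"
      then have e: "e \<subseteq> V" "card e = 2" "v \<in> e" by auto
      then obtain x y where "e = {x, y}" "x \<noteq> y" by (auto simp: card_2_iff)
      then show "e \<in> (\<lambda>w. {v, w}) ` (V - {v})" using e(1,3) by (auto simp: insert_commute)
    qed
  qed (use assms in auto)
  moreover have "inj_on (\<lambda>w. {v, w}) (V - {v})" by (auto simp: inj_on_def doubleton_eq_iff)
  ultimately show ?thesis using assms by (simp add: card_image)
qed

lemma card_pairs_between:
  assumes "finite V" "S \<subseteq> V" "T \<subseteq> V" "S \<inter> T = {}"
  shows "card {e \<in> pairs V. e \<inter> S \<noteq> {} \<and> e \<inter> T \<noteq> {}} = card S * card T"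
proof -
  have "{e \<in> pairs V. e \<inter> S \<noteq> {} \<and> e \<inter> T \<noteq> {}} = (\<lambda>(a, b). {a, b}) ` (S \<times> T)"
  proof
    show "{e \<in> pairs V. e \<inter> S \<noteq> {} \<and> e \<inter> T \<noteq> {}} \<subseteq> (\<lambda>(a, b). {a, b}) ` (S \<times> T)"
    proof
      fix e assume "e \<in> {e \<in> pairs V. e \<inter> S \<noteq> {} \<and> e \<inter> T \<noteq> {}}"
      then obtain a b where ab: "card e = 2" "a \<in> e" "a \<in> S" "b \<in> e" "b \<in> T" by auto
      then have "a \<noteq> b" using assms(4) by auto
      moreover obtain x y where "e = {x, y}" using ab(1) by (auto simp: card_2_iff)
      ultimately have "e = {a, b}" using ab by auto
      then show "e \<in> (\<lambda>(a, b). {a, b}) ` (S \<times> T)" using ab by auto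
    qed
    show "(\<lambda>(a, b). {a, b}) ` (S \<times> T) \<subseteq> {e \<in> pairs V. e \<inter> S \<noteq> {} \<and> e \<inter> T \<noteq> {}}"
    proof
      fix e assume "e \<in> (\<lambda>(a, b). {a, b}) ` (S \<times> T)"
      then obtain a b where ab: "a \<in> S" "b \<in> T" "e = {a, b}" by auto
      then have "a \<noteq> b" using assms(4) by auto
      then show "e \<in> {e \<in> pairs V. e \<inter> S \<noteq> {} \<and> e \<inter> T \<noteq> {}}" using ab assms(2,3) by auto
    qed
  qed
  moreover have "inj_on (\<lambda>(a, b). {a, b}) (S \<times> T)"
    using assms(4) by (auto simp: inj_on_def doubleton_eq_iff)
  ultimately show ?thesis using assms by (simp add: card_image card_cartesian_product)
qed

context
  fixes V :: "'a set" and p :: real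
  assumes fin: "finite V" and p: "0 \<le> p" "p \<le> 1"
begin

lemma prob_low_degree:
  "measure_pmf.prob (random_subset (pairs V) p)
     (\<Union>v\<in>V. {E. card ({e \<in> pairs V. v \<in> e} \<inter> E) \<le> 4/5 * p * (real (card V) - 1)}) \<le>
   card V * exp (- p * (real (card V) - 1) / 50)"
proof -
  have "measure_pmf.prob (random_subset (pairs V) p)
     (\<Union>v\<in>V. {E. card ({e \<in> pairs V. v \<in> e} \<inter> E) \<le> 4/5 * p * (real (card V) - 1)}) \<le>
     (\<Sum>v\<in>V. exp (- p * (real (card V) - 1) / 50))"
  proof (rule prob_UN_le[OF fin])
    fix v assume v: "v \<in> V"
    then have "1 \<le> card V" using fin by (metis Suc_leI One_nat_def card_gt_0_iff empty_iff)
    then have "real (card {e \<in> pairs V. v \<in> e}) = real (card V) - 1"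
      using card_pairs_at[OF fin v] by (simp add: of_nat_diff)
    then show "measure_pmf.prob (random_subset (pairs V) p)
        {E. card ({e \<in> pairs V. v \<in> e} \<inter> E) \<le> 4/5 * p * (real (card V) - 1)} \<le>
        exp (- p * (real (card V) - 1) / 50)"
      using prob_random_subset_few[OF finite_pairs[OF fin] p, of "{e \<in> pairs V. v \<in> e}"] by auto
  qed
  then show ?thesis by simp
qed

text \<open>A set of k \<le> 3s vertices has at most 3sk/2 pairs, so the upper tail decays
  geometrically in k; the constant is 1.72 * 3/2 = 2.58. Summing over all vertex sets is the
  binomial theorem, and the final -1 accounts for the empty set.\<close>

lemma prob_dense_small_set:
  fixes s b :: real
  shows "measure_pmf.prob (random_subset (pairs V) p)
     (\<Union>U\<in>{U. U \<subseteq> V \<and> U \<noteq> {} \<and> card U \<le> 3 * s}. {E. b * card U \<le> card (pairs U \<inter> E)}) \<le>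
   (1 + exp (258/100 * p * s - b)) ^ card V - 1"
proof -
  let ?q = "exp (258/100 * p * s - b)"
  let ?I = "{U. U \<subseteq> V \<and> U \<noteq> {} \<and> card U \<le> 3 * s}"
  have sub: "?I \<subseteq> Pow V - {{}}" by auto
  then have finI: "finite ?I" using fin by (auto intro: finite_subset)
  have "measure_pmf.prob (random_subset (pairs V) p)
     (\<Union>U\<in>?I. {E. b * card U \<le> card (pairs U \<inter> E)}) \<le> (\<Sum>U\<in>?I. ?q ^ card U)"
  proof (rule prob_UN_le[OF finI])
    fix U assume U: "U \<in> ?I"
    then have finU: "finite U" using fin finite_subset by auto
    have "real (card U) * card U \<le> card U * (3 * s)" using U by (intro mult_left_mono) auto
    then have "real (card (pairs U)) \<le> card U * (3 * s) / 2"
      using card_pairs_le[OF finU] by simp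
    then have "172/100 * p * card (pairs U) \<le> 172/100 * p * (card U * (3 * s) / 2)"
      using p by (intro mult_left_mono) auto
    then have e: "172/100 * p * card (pairs U) - b * card U \<le> card U * (258/100 * p * s - b)"
      by (simp add: algebra_simps)
    have "measure_pmf.prob (random_subset (pairs V) p) {E. b * card U \<le> card (pairs U \<inter> E)} \<le>
        exp (172/100 * p * card (pairs U) - b * card U)"
      using U by (intro prob_random_subset_upper_tail finite_pairs[OF fin] p) auto
    also have "\<dots> \<le> exp (card U * (258/100 * p * s - b))" using e by simp
    also have "\<dots> = ?q ^ card U" by (rule exp_of_nat_mult)
    finally show "measure_pmf.prob (random_subset (pairs V) p)
        {E. b * card U \<le> card (pairs U \<inter> E)} \<le> ?q ^ card U" .
  qed
  also have "\<dots> \<le> (\<Sum>U\<in>Pow V - {{}}. ?q ^ card U)"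
    using fin sub by (intro sum_mono2) auto
  also have "\<dots> = (\<Sum>U\<in>Pow V. ?q ^ card U) - 1" using fin by (simp add: sum_diff1)
  also have "\<dots> = (1 + ?q) ^ card V - 1" by (simp add: sum_Pow_power_card[OF fin])
  finally show ?thesis .
qed

text \<open>There are at most 4^n pairs of sets, each spanning at least sn/4 vertex pairs; the 200
  is 50 * 4.\<close>

lemma prob_sparse_cut:
  fixes s :: real
  assumes "0 \<le> s"
  shows "measure_pmf.prob (random_subset (pairs V) p)
     (\<Union>(S, T)\<in>{(S, T). S \<subseteq> V \<and> T \<subseteq> V \<and> S \<inter> T = {} \<and> s < card S \<and> card V \<le> 4 * card T}.
       {E. card ({e \<in> pairs V. e \<inter> S \<noteq> {} \<and> e \<inter> T \<noteq> {}} \<inter> E) \<le> 4/5 * p * (card S * card T)}) \<le>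
   4 ^ card V * exp (- p * s * card V / 200)"
proof -
  let ?I = "{(S, T). S \<subseteq> V \<and> T \<subseteq> V \<and> S \<inter> T = {} \<and> s < card S \<and> card V \<le> 4 * card T}"
  have sub: "?I \<subseteq> Pow V \<times> Pow V" by auto
  have finI: "finite ?I" using fin by (intro finite_subset[OF sub]) auto
  have "card ?I \<le> card (Pow V \<times> Pow V)" using fin by (intro card_mono[OF _ sub]) auto
  also have "\<dots> = 4 ^ card V"
    using fin by (simp add: card_cartesian_product card_Pow power_mult_distrib[symmetric])
  finally have "real (card ?I) \<le> real (4 ^ card V)" by (rule of_nat_mono)
  then have cardI: "real (card ?I) \<le> 4 ^ card V" by simp
  have "measure_pmf.prob (random_subset (pairs V) p)
     (\<Union>(S, T)\<in>?I. {E. card ({e \<in> pairs V. e \<inter> S \<noteq> {} \<and> e \<inter> T \<noteq> {}} \<inter> E) \<le>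
        4/5 * p * (card S * card T)}) \<le> (\<Sum>i\<in>?I. exp (- p * s * card V / 200))"
  proof (rule prob_UN_le[OF finI], clarify)
    fix S T assume ST: "S \<subseteq> V" "T \<subseteq> V" "S \<inter> T = {}" "s < card S" "card V \<le> 4 * card T"
    let ?F = "{e \<in> pairs V. e \<inter> S \<noteq> {} \<and> e \<inter> T \<noteq> {}}"
    have "real (card V) \<le> real (4 * card T)" using ST(5) by (rule of_nat_mono)
    then have "s * (card V / 4) \<le> real (card S * card T)"
      unfolding of_nat_mult using ST(4) assms by (intro mult_mono) auto
    then have "p * (s * (card V / 4)) \<le> p * (card S * card T)" using p by (intro mult_left_mono) auto
    then have e: "- p * (card S * card T) / 50 \<le> - p * s * card V / 200" by simp
    have "measure_pmf.prob (random_subset (pairs V) p)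
        {E. card (?F \<inter> E) \<le> 4/5 * p * (card S * card T)} \<le> exp (- p * (card S * card T) / 50)"
      using prob_random_subset_few[OF finite_pairs[OF fin] p, of ?F]
      unfolding card_pairs_between[OF fin ST(1-3)] by blast
    also have "\<dots> \<le> exp (- p * s * card V / 200)" using e by simp
    finally show "measure_pmf.prob (random_subset (pairs V) p)
        {E. card (?F \<inter> E) \<le> 4/5 * p * (card S * card T)} \<le> exp (- p * s * card V / 200)" .
  qed
  also have "\<dots> = card ?I * exp (- p * s * card V / 200)" by simp
  also have "\<dots> \<le> 4 ^ card V * exp (- p * s * card V / 200)" using cardI by (rule mult_right_mono) simp
  finally show ?thesis .
qed

text \<open>The threshold is at least twice the mean, and 1.72/2 - 1 = -0.14.\<close>

lemma prob_many_edges: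
  "measure_pmf.prob (random_subset (pairs V) p) {E. p * card V * card V \<le> card (pairs V \<inter> E)} \<le>
   exp (- 14/100 * (p * card V * card V))"
proof -
  have "172/100 * p * card (pairs V) \<le> 172/100 * p * (card V * card V / 2)"
    using p card_pairs_le[OF fin] by (intro mult_left_mono) auto
  then have e: "172/100 * p * card (pairs V) - p * card V * card V \<le> - 14/100 * (p * card V * card V)"
    by (simp add: algebra_simps)
  have "measure_pmf.prob (random_subset (pairs V) p) {E. p * card V * card V \<le> card (pairs V \<inter> E)} \<le>
      exp (172/100 * p * card (pairs V) - p * card V * card V)"
    by (intro prob_random_subset_upper_tail finite_pairs[OF fin] p) auto
  also have "\<dots> \<le> exp (- 14/100 * (p * card V * card V))" using e by simp
  finally show ?thesis .
qed

text \<open>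
  Markov's inequality for the number of subgraphs with at most \<open>\<tau>\<close> edges that miss their own target
  set: weighting a subgraph with \<open>k\<close> edges by \<open>L powr (\<tau> - k) \<ge> 1\<close> turns the sum over small
  subgraphs into a binomial sum.
\<close>

lemma prob_small_subgraph_misses:
  fixes L \<tau> \<beta> :: real
  assumes "1 \<le> L"
    and \<G>: "\<And>\<Gamma>. \<Gamma> \<in> \<G> \<Longrightarrow> \<Gamma> \<subseteq> pairs V \<and> card \<Gamma> \<le> \<tau> \<and> F \<Gamma> \<subseteq> pairs V \<and> F \<Gamma> \<inter> \<Gamma> = {} \<and> \<beta> \<le> card (F \<Gamma>)"
  shows "measure_pmf.prob (random_subset (pairs V) p)
     (\<Union>\<Gamma>\<in>\<G>. {E. \<Gamma> \<subseteq> E \<and> card (F \<Gamma> \<inter> E) \<le> 4/5 * p * card (F \<Gamma>)}) \<le>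
   exp (\<tau> * ln L + p * card V * card V / (2 * L) - p * \<beta> / 50)"
proof -
  have sub: "\<G> \<subseteq> Pow (pairs V)" using \<G> by blast
  have finG: "finite \<G>" using finite_pairs[OF fin] by (intro finite_subset[OF sub]) auto
  let ?c = "L powr \<tau> * exp (- p * \<beta> / 50)"
  have "measure_pmf.prob (random_subset (pairs V) p)
     (\<Union>\<Gamma>\<in>\<G>. {E. \<Gamma> \<subseteq> E \<and> card (F \<Gamma> \<inter> E) \<le> 4/5 * p * card (F \<Gamma>)}) \<le>
     (\<Sum>\<Gamma>\<in>\<G>. ?c * (p / L) ^ card \<Gamma>)"
  proof (rule prob_UN_le[OF finG])
    fix \<Gamma> assume "\<Gamma> \<in> \<G>"
    note \<Gamma> = \<G>[OF this]
    have "p * \<beta> \<le> p * card (F \<Gamma>)" using \<Gamma> p by (intro mult_left_mono) auto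
    then have e: "exp (- p * card (F \<Gamma>) / 50) \<le> exp (- p * \<beta> / 50)" by simp
    have "L powr card \<Gamma> \<le> L powr \<tau>" using \<Gamma> assms(1) by (intro powr_mono) auto
    then have "L ^ card \<Gamma> \<le> L powr \<tau>" using assms(1) by (simp add: powr_realpow)
    then have "L ^ card \<Gamma> * (p / L) ^ card \<Gamma> \<le> L powr \<tau> * (p / L) ^ card \<Gamma>"
      using assms(1) p by (intro mult_right_mono) auto
    moreover have "L ^ card \<Gamma> * (p / L) ^ card \<Gamma> = p ^ card \<Gamma>"
      using assms(1) by (simp add: power_mult_distrib[symmetric])
    ultimately have k: "p ^ card \<Gamma> \<le> L powr \<tau> * (p / L) ^ card \<Gamma>" by simp
    have "measure_pmf.prob (random_subset (pairs V) p)
        {E. \<Gamma> \<subseteq> E \<and> card (F \<Gamma> \<inter> E) \<le> 4/5 * p * card (F \<Gamma>)} \<le>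
        p ^ card \<Gamma> * exp (- p * card (F \<Gamma>) / 50)"
      using \<Gamma> by (intro prob_random_subset_lower_tail finite_pairs[OF fin] p) auto
    also have "\<dots> \<le> (L powr \<tau> * (p / L) ^ card \<Gamma>) * exp (- p * \<beta> / 50)"
      using k e assms(1) p by (intro mult_mono) auto
    finally show "measure_pmf.prob (random_subset (pairs V) p)
        {E. \<Gamma> \<subseteq> E \<and> card (F \<Gamma> \<inter> E) \<le> 4/5 * p * card (F \<Gamma>)} \<le> ?c * (p / L) ^ card \<Gamma>"
      by (simp add: mult_ac)
  qed
  also have "\<dots> \<le> (\<Sum>\<Gamma>\<in>Pow (pairs V). ?c * (p / L) ^ card \<Gamma>)"
    using finite_pairs[OF fin] sub assms(1) p by (intro sum_mono2) auto
  also have "\<dots> = ?c * (1 + p / L) ^ card (pairs V)"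
    by (simp add: sum_distrib_left[symmetric] sum_Pow_power_card[OF finite_pairs[OF fin]])
  also have "\<dots> \<le> ?c * exp (p * card V * card V / (2 * L))"
  proof (rule mult_left_mono)
    have "(1 + p / L) ^ card (pairs V) \<le> exp (p / L) ^ card (pairs V)"
      using assms(1) p by (intro power_mono) auto
    also have "\<dots> = exp (card (pairs V) * (p / L))" by (rule exp_of_nat_mult[symmetric])
    also have "card (pairs V) * (p / L) \<le> (card V * card V / 2) * (p / L)"
      using assms(1) p card_pairs_le[OF fin] by (intro mult_right_mono) auto
    finally show "(1 + p / L) ^ card (pairs V) \<le> exp (p * card V * card V / (2 * L))"
      by (simp add: mult_ac)
  qed simp
  also have "\<dots> = exp (\<tau> * ln L) * exp (- p * \<beta> / 50) * exp (p * card V * card V / (2 * L))"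
    using assms(1) by (simp add: powr_def)
  also have "\<dots> = exp (\<tau> * ln L + p * card V * card V / (2 * L) - p * \<beta> / 50)"
    unfolding mult_exp_exp by (simp add: algebra_simps)
  finally show ?thesis .
qed

end

section \<open>Local resilience\<close>

text \<open>
  The sparsity parameter is \<open>\<delta> = 1 / 10 ^ 12\<close>. The union bound over subgraphs with at most
  \<open>\<tau> = 3 \<delta> n d\<close> edges, with weight \<open>L = 10 ^ 5\<close>, needs \<open>3 \<delta> L + 1 / (2 L) < 1 / 11520\<close>.
\<close>

lemma prob_deletion_not_HAM:
  fixes V :: "'a set" and p :: real
  defines "n \<equiv> real (card V)"
  assumes fin: "finite V" and p: "0 \<le> p" "p \<le> 1" and n: "24 \<le> card V" and d: "10 ^ 30 \<le> n * p"
  shows "measure_pmf.prob (random_subset (pairs V) p)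
      {E. \<exists>H\<subseteq>E. (\<forall>v\<in>V. card {e\<in>H. v \<in> e} \<le> n * p / 6) \<and> (V, E - H) \<notin> HAM} \<le>
    n * exp (- p * (n - 1) / 50) + ((1 + exp (- (n * p) / 10 ^ 14)) ^ card V - 1) +
    4 ^ card V * exp (- (n * (n * p)) / 10 ^ 16) + 2 * exp (- (n * (n * p)) / 10 ^ 16)"
proof -
  let ?M = "random_subset (pairs V) p"

  \<comment> \<open>Parameters, and a booster family for every sparse expander\<close>
  define d where "d = n * p"
  have d_large: "10 ^ 30 \<le> d" using d by (simp add: d_def)
  have n24: "24 \<le> n" using n by (simp add: n_def)
  \<comment> \<open>\<open>b\<close> is one sixth of the sparsity parameter times \<open>d\<close>,
    to match \<open>6 * card {e\<in>E. e \<subseteq> U} < D * card U\<close>. \<open>s\<close> is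
    small enough that 2.58ps stays below \<open>b\<close>. \<beta> is (n/48)(5n/24), a lower bound
    for the number of boosters.\<close>
  define s where "s = n / (36 * 10 ^ 12)"
  define b where "b = d / (6 * 10 ^ 12)"
  define \<tau> where "\<tau> = 3 * n * d / 10 ^ 12"
  define \<beta> where "\<beta> = 5 * n * n / 1152"
  define m where "m = card V div 24"
  define \<G> where "\<G> = {\<Gamma>. \<Gamma> \<subseteq> pairs V \<and> expander V \<Gamma> \<and> (V, \<Gamma>) \<notin> HAM \<and> card \<Gamma> \<le> \<tau>}"
  define Q where "Q \<Gamma> A F \<longleftrightarrow> A \<subseteq> V \<and> card A = m \<and> F \<subseteq> pairs V \<and> F \<inter> \<Gamma> = {} \<and>
      (\<forall>e\<in>F. booster V \<Gamma> e \<and> e \<inter> A \<noteq> {}) \<and> m * (n / 4 - m) \<le> card F" for \<Gamma> A F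
  have "\<exists>A F. Q \<Gamma> A F" if "\<Gamma> \<in> \<G>" for \<Gamma>
  proof -
    have G: "\<Gamma> \<subseteq> pairs V" "expander V \<Gamma>" "(V, \<Gamma>) \<notin> HAM" using that by (auto simp: \<G>_def)
    have "12 \<le> card V" "4 * m \<le> card V" using n by (auto simp: m_def)
    then show ?thesis
    proof (rule booster_family[OF fin G])
      fix A F
      assume "A \<subseteq> V" "card A = m" "F \<subseteq> pairs V" "F \<inter> \<Gamma> = {}" "\<And>e. e \<in> F \<Longrightarrow> booster V \<Gamma> e"
        "\<And>e. e \<in> F \<Longrightarrow> e \<inter> A \<noteq> {}" "m * (real (card V) / 4 - m) \<le> card F"
      then show ?thesis unfolding Q_def n_def by (intro exI[of _ A] exI[of _ F]) simp
    qed
  qed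
  \<comment> \<open>The choice depends on \<Gamma> alone, not on the random edge set, so the union
    bound runs over \<Gamma> only.\<close>
  then obtain A F where "\<And>\<Gamma>. \<Gamma> \<in> \<G> \<Longrightarrow> Q \<Gamma> (A \<Gamma>) (F \<Gamma>)" by metis
  then have AF: "\<And>\<Gamma>. \<Gamma> \<in> \<G> \<Longrightarrow> A \<Gamma> \<subseteq> V \<and> card (A \<Gamma>) = m \<and> F \<Gamma> \<subseteq> pairs V \<and> F \<Gamma> \<inter> \<Gamma> = {} \<and>
      (\<forall>e\<in>F \<Gamma>. booster V \<Gamma> e \<and> e \<inter> A \<Gamma> \<noteq> {}) \<and> m * (n / 4 - m) \<le> card (F \<Gamma>)"
    unfolding Q_def .
  have m: "n / 48 \<le> m" "m \<le> n / 24"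
  proof -
    have "card V = 24 * m + card V mod 24" "card V mod 24 < 24" by (simp_all add: m_def)
    moreover from this have "1 \<le> m" using n by linarith
    ultimately have "card V \<le> 48 * m" by linarith
    moreover have "24 * m \<le> card V" unfolding m_def by (rule times_div_less_eq_dividend)
    ultimately
    have "real (card V) \<le> real (48 * m)" "real (24 * m) \<le> real (card V)"
      by (simp_all only: of_nat_le_iff)
    then show "n / 48 \<le> m" "m \<le> n / 24" by (simp_all add: n_def)
  qed
  \<comment> \<open>From m \<le> n/24 one gets n/4 - m \<ge> 5n/24. The number 5/24 is chosen
    because 4/5 * 5/24 = 1/6.\<close>
  have mF: "m * (5 * n / 24) \<le> card (F \<Gamma>)" if "\<Gamma> \<in> \<G>" for \<Gamma>
  proof -
    have "m * (5 * n / 24) \<le> m * (n / 4 - m)" using m by (intro mult_left_mono) auto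
    then show ?thesis using AF[OF that] by linarith
  qed
  have \<beta>F: "\<beta> \<le> card (F \<Gamma>)" if "\<Gamma> \<in> \<G>" for \<Gamma>
  proof -
    have "n / 48 * (5 * n / 24) \<le> m * (5 * n / 24)" using m n24 by (intro mult_right_mono) auto
    moreover have "\<beta> = n / 48 * (5 * n / 24)" by (simp add: \<beta>_def)
    ultimately show ?thesis using mF[OF that] by linarith
  qed

  \<comment> \<open>The five exceptional events\<close>
  define B1 where "B1 = (\<Union>v\<in>V. {E. card ({e \<in> pairs V. v \<in> e} \<inter> E) \<le> 4/5 * p * (n - 1)})"
  define B2 where "B2 = (\<Union>U\<in>{U. U \<subseteq> V \<and> U \<noteq> {} \<and> card U \<le> 3 * s}. {E. b * card U \<le> card (pairs U \<inter> E)})"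
  define B3 where "B3 = (\<Union>(S, T)\<in>{(S, T). S \<subseteq> V \<and> T \<subseteq> V \<and> S \<inter> T = {} \<and> s < card S \<and> card V \<le> 4 * card T}.
       {E. card ({e \<in> pairs V. e \<inter> S \<noteq> {} \<and> e \<inter> T \<noteq> {}} \<inter> E) \<le> 4/5 * p * (card S * card T)})"
  define B4 where "B4 = {E. p * n * n \<le> card (pairs V \<inter> E)}"
  define B5 where "B5 = (\<Union>\<Gamma>\<in>\<G>. {E. \<Gamma> \<subseteq> E \<and> card (F \<Gamma> \<inter> E) \<le> 4/5 * p * card (F \<Gamma>)})"

  \<comment> \<open>Probabilities of the exceptional events\<close>
  have P1: "measure_pmf.prob ?M B1 \<le> n * exp (- p * (n - 1) / 50)"
    unfolding B1_def n_def by (rule prob_low_degree[OF fin p])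
  have P2: "measure_pmf.prob ?M B2 \<le> (1 + exp (- (n * p) / 10 ^ 14)) ^ card V - 1"
  proof -
    have "258/100 * p * s - b \<le> - (n * p) / 10 ^ 14"
      using d_large unfolding s_def b_def d_def by (simp add: field_simps)
    then have "(1 + exp (258/100 * p * s - b)) ^ card V \<le> (1 + exp (- (n * p) / 10 ^ 14)) ^ card V"
      by (intro power_mono) (auto simp: add_nonneg_nonneg)
    then show ?thesis using prob_dense_small_set[OF fin p, of b s] unfolding B2_def by linarith
  qed
  have P3: "measure_pmf.prob ?M B3 \<le> 4 ^ card V * exp (- (n * (n * p)) / 10 ^ 16)"
  proof -
    have "0 \<le> s" using n24 by (simp add: s_def)
    have "0 \<le> n * (n * p)" using n24 p by simp
    then have "- p * s * n / 200 \<le> - (n * (n * p)) / 10 ^ 16"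
      unfolding s_def by (simp add: field_simps)
    then have "4 ^ card V * exp (- p * s * n / 200) \<le> 4 ^ card V * exp (- (n * (n * p)) / 10 ^ 16)"
      by simp
    then show ?thesis
      using prob_sparse_cut[OF fin p \<open>0 \<le> s\<close>] unfolding B3_def n_def by linarith
  qed
  have P4: "measure_pmf.prob ?M B4 \<le> exp (- (n * (n * p)) / 10 ^ 16)"
  proof -
    have "0 \<le> n * (n * p)" using n24 p by simp
    then have "- 14/100 * (p * n * n) \<le> - (n * (n * p)) / 10 ^ 16" by (simp add: field_simps)
    then have "exp (- 14/100 * (p * n * n)) \<le> exp (- (n * (n * p)) / 10 ^ 16)" by simp
    then show ?thesis using prob_many_edges[OF fin p] unfolding B4_def n_def by linarith
  qed
  have P5: "measure_pmf.prob ?M B5 \<le> exp (- (n * (n * p)) / 10 ^ 16)"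
  proof -
    have nd: "0 \<le> n * d" using n24 d_large by simp
    have \<tau>: "\<tau> = 3 * (n * d) / 10 ^ 12" by (simp add: \<tau>_def)
    then have "0 \<le> \<tau>" using nd by simp
    \<comment> \<open>This crude bound suffices: in units of nd, the positive terms 3/10^7 and 1/(2
      * 10^5) stay well below 1/11520.\<close>
    moreover have "ln (10 ^ 5 :: real) \<le> 10 ^ 5 - 1" by (rule ln_le_minus_one) simp
    ultimately have "\<tau> * ln (10 ^ 5) \<le> \<tau> * (10 ^ 5 - 1)" by (intro mult_left_mono) auto
    also have "\<dots> \<le> 3 * (n * d) / 10 ^ 7"
    proof -
      have "3 * z / 10 ^ 12 * (10 ^ 5 - 1) \<le> 3 * z / 10 ^ 7" if "0 \<le> z" for z :: real
        using that by simp
      from this[OF nd] show ?thesis by (simp only: \<tau>)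
    qed
    finally have "\<tau> * ln (10 ^ 5) \<le> 3 * (n * d) / 10 ^ 7" .
    moreover have "p * n * n / (2 * 10 ^ 5) = n * d / (2 * 10 ^ 5)" by (simp add: d_def mult_ac)
    moreover have "p * \<beta> / 50 = n * d / 11520" by (simp add: d_def \<beta>_def field_simps)
    moreover have "3 * z / 10 ^ 7 + z / (2 * 10 ^ 5) - z / 11520 \<le> - z / 10 ^ 16" if "0 \<le> z" for z :: real
      using that by simp
    from this[OF nd] have "3 * (n * d) / 10 ^ 7 + n * d / (2 * 10 ^ 5) - n * d / 11520 \<le> - (n * d) / 10 ^ 16" .
    ultimately have "\<tau> * ln (10 ^ 5) + p * n * n / (2 * 10 ^ 5) - p * \<beta> / 50 \<le> - (n * d) / 10 ^ 16"
      by linarith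
    then have "exp (\<tau> * ln (10 ^ 5) + p * n * n / (2 * 10 ^ 5) - p * \<beta> / 50) \<le> exp (- (n * (n * p)) / 10 ^ 16)"
      by (simp add: d_def)
    moreover have "measure_pmf.prob ?M B5 \<le> exp (\<tau> * ln (10 ^ 5) + p * n * n / (2 * 10 ^ 5) - p * \<beta> / 50)"
      unfolding B5_def n_def using AF \<beta>F
      by (intro prob_small_subgraph_misses[OF fin p]) (auto simp: \<G>_def)
    ultimately show ?thesis by linarith
  qed

  \<comment> \<open>Hamiltonicity after deletion outside the exceptional events\<close>
  have det: "(V, E - H) \<in> HAM"
    if E: "E \<subseteq> pairs V" "E \<notin> B1" "E \<notin> B2" "E \<notin> B3" "E \<notin> B4" "E \<notin> B5"
      and H: "H \<subseteq> E" "\<And>v. v \<in> V \<Longrightarrow> card {e\<in>H. v \<in> e} \<le> d / 6" for E H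
  proof -
    \<comment> \<open>Here 1080 = 36 * 30, so \<rho>nd = sd/30. With t \<ge> 2n/\<rho> the hitting
      bound becomes 4^n exp(-2n), which is below 1.\<close>
    define \<rho> :: real where "\<rho> = 1 / (1080 * 10 ^ 12)"
    define D where "D = nat \<lceil>d / 10 ^ 12\<rceil>"
    define t where "t = nat \<lceil>2 * n / \<rho>\<rceil>"
    have nat_ceiling: "x \<le> nat \<lceil>x\<rceil>" "nat \<lceil>x\<rceil> \<le> x + 1" if "0 \<le> x" for x :: real
      using that by linarith+
    have D: "d / 10 ^ 12 \<le> D" "D \<le> d / 10 ^ 12 + 1"
      unfolding D_def using nat_ceiling[of "d / 10 ^ 12"] d_large by auto
    have t: "2 * n / \<rho> \<le> t" "t \<le> 2 * n / \<rho> + 1"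
    proof -
      have "0 \<le> 2 * n / \<rho>" using n24 by (simp add: \<rho>_def)
      then show "2 * n / \<rho> \<le> t" "t \<le> 2 * n / \<rho> + 1" unfolding t_def using nat_ceiling by auto
    qed
    have cap: "{e \<in> pairs V. P e} \<inter> E = {e\<in>E. P e}" for P using E(1) by auto
    show ?thesis
    proof (rule HAM_after_deletion[OF fin _ E(1) H, where s = s and \<rho> = \<rho> and D = D and t = t])
      show "V \<noteq> {}" using n by auto
      show "0 < \<rho>" "\<rho> \<le> 1" by (simp_all add: \<rho>_def)
      show "0 < D" using D(1) d_large by (simp add: field_simps)
    next
      fix v assume v: "v \<in> V"
      have "\<not> card ({e \<in> pairs V. v \<in> e} \<inter> E) \<le> 4/5 * p * (n - 1)"
        using E(2) v unfolding B1_def by blast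
      then have "4/5 * p * (n - 1) < card {e\<in>E. v \<in> e}" unfolding cap not_le .
      moreover have "4/5 * p * (n - 1) = 4/5 * d - 4/5 * p" by (simp add: d_def field_simps)
      ultimately show "D + d / 6 \<le> card {e\<in>E. v \<in> e}" using D(2) d_large p(2) by simp
    next
      fix U assume U: "U \<subseteq> V" "U \<noteq> {}" "card U \<le> 3 * s"
      have "\<not> b * card U \<le> card (pairs U \<inter> E)" using E(3) U unfolding B2_def by blast
      then have "card (pairs U \<inter> E) < b * card U" by (simp only: not_le)
      moreover have "pairs U \<inter> E = {e\<in>E. e \<subseteq> U}" using E(1) by auto
      ultimately have "6 * real (card {e\<in>E. e \<subseteq> U}) < d / 10 ^ 12 * card U" by (simp add: b_def)
      also have "\<dots> \<le> real D * card U" using D(1) by (intro mult_right_mono) auto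
      finally have "real (6 * card {e\<in>E. e \<subseteq> U}) < real (D * card U)" by simp
      then show "6 * card {e\<in>E. e \<subseteq> U} < D * card U" by (simp only: of_nat_less_iff)
    next
      fix S T assume ST: "S \<subseteq> V" "T \<subseteq> V" "S \<inter> T = {}" "s < card S" "card V \<le> 4 * card T"
      have "real (card V) \<le> real (4 * card T)" using ST(5) by (rule of_nat_mono)
      then have T: "n / 4 \<le> card T" by (simp add: n_def)
      have "(S, T) \<in> {(S, T). S \<subseteq> V \<and> T \<subseteq> V \<and> S \<inter> T = {} \<and> s < card S \<and> card V \<le> 4 * card T}"
        using ST by simp
      then have "\<not> card ({e \<in> pairs V. e \<inter> S \<noteq> {} \<and> e \<inter> T \<noteq> {}} \<inter> E) \<le> 4/5 * p * (card S * card T)"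
        using E(4) unfolding B3_def by blast
      then have "4/5 * p * (card S * card T) < card {e\<in>E. e \<inter> S \<noteq> {} \<and> e \<inter> T \<noteq> {}}"
        unfolding cap not_le .
      moreover have "4/5 * p * (card S * (n / 4)) \<le> 4/5 * p * (card S * card T)"
        unfolding of_nat_mult using T p(1) by (intro mult_left_mono) auto
      \<comment> \<open>The cut has more than |S|d/5 = |S|d/6 + |S|d/30 edges: the first part pays
        for \<open>H\<close>, the second for the \<rho>-fraction of all edges.\<close>
      moreover have "4/5 * p * (card S * (n / 4)) = card S * d / 5" by (simp add: d_def)
      moreover have "\<rho> * card E \<le> card S * d / 30"
      proof -
        have "card (pairs V \<inter> E) < n * d" using E(5) unfolding B4_def d_def by (simp add: mult_ac)
        moreover have "pairs V \<inter> E = E" using E(1) by auto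
        ultimately have "\<rho> * card E \<le> \<rho> * (n * d)" by (intro mult_left_mono) (auto simp: \<rho>_def)
        also have "\<dots> = s * d / 30" by (simp add: \<rho>_def s_def)
        also have "\<dots> \<le> card S * d / 30"
          using ST(4) d_large by (intro divide_right_mono mult_right_mono) auto
        finally show ?thesis .
      qed
      ultimately show "\<rho> * card E + card S * (d / 6) \<le> card {e\<in>E. e \<inter> S \<noteq> {} \<and> e \<inter> T \<noteq> {}}"
        by linarith
    next
      have "(5::real) \<le> exp 2" using exp_lower_Taylor_quadratic[of 2] by simp
      then have "4 * exp (- 2) < (1::real)" by (simp add: exp_minus field_simps)
      then have "(4 * exp (- 2)) ^ card V < (1::real)"
        using n by (intro power_less_one_iff[THEN iffD2]) auto
      then have "4 ^ card V * exp (- 2 * n) < 1"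
        by (simp add: power_mult_distrib exp_of_nat_mult[symmetric] n_def mult.commute)
      moreover have "exp (- \<rho> * t) \<le> exp (- 2 * n)" using t(1) by (simp add: \<rho>_def)
      then have "4 ^ card V * exp (- \<rho> * t) \<le> 4 ^ card V * exp (- 2 * n)" by (rule mult_left_mono) simp
      ultimately show "4 ^ card V * exp (- \<rho> * t) < 1" by linarith
    next
      fix E' assume E': "E' \<subseteq> E" "expander V E'" "(V, E') \<notin> HAM" "card E' \<le> card V * D + t + card V"
      have "real (card E') \<le> real (card V * D + t + card V)" using E'(4) by (rule of_nat_mono)
      also have "\<dots> = n * D + t + n" by (simp add: n_def)
      also have "\<dots> \<le> n * (d / 10 ^ 12 + 1) + (2 * n / \<rho> + 1) + n"
        using D t n24 by (intro add_mono mult_left_mono) auto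
      also have "\<dots> \<le> n * (d / 10 ^ 12 + 1) + (2 * n / \<rho> + n) + n" using n24 by simp
      also have "\<dots> = n * (d / 10 ^ 12 + (3 + 2 * 1080 * 10 ^ 12))" by (simp add: \<rho>_def algebra_simps)
      \<comment> \<open>The hitting set and the added boosters contribute only linearly many edges,
        absorbed because \<open>d\<close> is at least 10^30.\<close>
      also have "\<dots> \<le> n * (3 * d / 10 ^ 12)" using d_large n24 by (intro mult_left_mono) auto
      finally have "E' \<in> \<G>" using E' E(1) by (auto simp: \<G>_def \<tau>_def)
      note AF' = AF[OF this] mF[OF this]
      \<comment> \<open>The constant 1/6 is attained here with equality; the strict inequality comes
        from avoiding \<open>B5\<close>.\<close>
      have "card (A E') * (d / 6) = 4/5 * p * (m * (5 * n / 24))" using AF' by (simp add: d_def)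
      also have "\<dots> \<le> 4/5 * p * card (F E')" using AF'(2) p(1) by (intro mult_left_mono) auto
      also have "\<dots> < card (F E' \<inter> E)"
      proof -
        have "\<not> card (F E' \<inter> E) \<le> 4/5 * p * card (F E')"
          using E(6) E'(1) \<open>E' \<in> \<G>\<close> unfolding B5_def by blast
        then show ?thesis by (simp only: not_le)
      qed
      finally show "\<exists>A F. A \<subseteq> V \<and> (\<forall>e\<in>F. booster V E' e \<and> e \<inter> A \<noteq> {}) \<and>
          card A * (d / 6) < card (F \<inter> E)" using AF' by blast
    qed
  qed

  \<comment> \<open>Union bound over the exceptional events\<close>
  let ?S = "{E. \<exists>H\<subseteq>E. (\<forall>v\<in>V. card {e\<in>H. v \<in> e} \<le> n * p / 6) \<and> (V, E - H) \<notin> HAM}"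
  have "measure_pmf.prob ?M ?S = measure_pmf.prob ?M (?S \<inter> set_pmf ?M)"
    by (simp add: measure_Int_set_pmf)
  also have "\<dots> \<le> measure_pmf.prob ?M (B1 \<union> B2 \<union> B3 \<union> B4 \<union> B5)"
  proof (rule measure_pmf.finite_measure_mono)
    show "?S \<inter> set_pmf ?M \<subseteq> B1 \<union> B2 \<union> B3 \<union> B4 \<union> B5"
    proof
      fix E assume "E \<in> ?S \<inter> set_pmf ?M"
      then obtain H where "E \<subseteq> pairs V" "H \<subseteq> E" "\<forall>v\<in>V. card {e\<in>H. v \<in> e} \<le> d / 6" "(V, E - H) \<notin> HAM"
        using set_random_subset[of "pairs V" p] by (auto simp: d_def)
      then show "E \<in> B1 \<union> B2 \<union> B3 \<union> B4 \<union> B5" using det[of E H] by blast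
    qed
  qed simp
  also have "\<dots> \<le> measure_pmf.prob ?M B1 + measure_pmf.prob ?M B2 + measure_pmf.prob ?M B3 +
      measure_pmf.prob ?M B4 + measure_pmf.prob ?M B5"
    by (intro order.trans[OF measure_Un_le] add_right_mono order.refl) simp_all
  also have "\<dots> \<le> n * exp (- p * (n - 1) / 50) + ((1 + exp (- (n * p) / 10 ^ 14)) ^ card V - 1) +
    4 ^ card V * exp (- (n * (n * p)) / 10 ^ 16) + 2 * exp (- (n * (n * p)) / 10 ^ 16)"
    using P1 P2 P3 P4 P5 by linarith
  finally show ?thesis .
qed


text \<open>The minimum defining the resilience is attained, and the edge set of an attaining
  subgraph is the witness.\<close>

lemma local_resilience_HAM_less:
  fixes r :: real
  assumes "finite V" "real (local_resilience (V, E) HAM) < r"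
  shows "\<exists>H\<subseteq>E. (\<forall>v\<in>V. card {e\<in>H. v \<in> e} < r) \<and> (V, E - H) \<notin> HAM"
proof -
  obtain H where H: "spanning_subgraph H (V, E)" "max_degree H = local_resilience (V, E) HAM"
    "delete_edges (V, E) H \<notin> HAM"
    using local_resilience_HAM_attained[of "(V, E)"] by blast
  have "real (card {e\<in>edges H. v \<in> e}) < r" if "v \<in> V" for v
  proof -
    have "vertex_degree H v \<le> max_degree H"
      using H(1) that assms(1) unfolding max_degree_def
      by (intro Max_ge) (auto simp: spanning_subgraph_def verts_def)
    then have "real (vertex_degree H v) \<le> real (max_degree H)" by (rule of_nat_mono)
    then show ?thesis using assms(2) H(2) by (simp add: vertex_degree_def)
  qed
  moreover have "edges H \<subseteq> E" "(V, E - edges H) \<notin> HAM"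
    using H(1,3) by (auto simp: spanning_subgraph_def delete_edges_def verts_def edges_def)
  ultimately show ?thesis by (intro exI[of _ "edges H"]) simp
qed

text \<open>A failure yields an \<open>H\<close> of maximum degree below np/6 that destroys
  Hamiltonicity. As np \<ge> 10^30 ln n, every exponent absorbs its constant, which leaves an error
  depending on n alone and hence uniform in \<open>p\<close>.\<close>

lemma prob_local_resilience_HAM_ge:
  fixes p \<epsilon> :: real
  assumes p: "0 \<le> p" "p \<le> 1" and n: "24 \<le> n" and K: "10 ^ 30 * ln (real n) / real n \<le> p" and "0 < \<epsilon>"
  shows "1 - (real n * exp (- 2 * ln (real n)) + ((1 + exp (- 2 * ln (real n))) ^ n - 1) +
      4 ^ n * exp (- 2 * real n * ln (real n)) + 2 * exp (- 2 * real n * ln (real n)))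
    \<le> measure_pmf.prob (binomial_random_graph n p)
        {G. real (local_resilience G HAM) \<ge> (1 - \<epsilon>) * real n * p / 6}"
proof -
  let ?V = "{1..n}" and ?N = "real n"
  let ?S = "{G. real (local_resilience G HAM) \<ge> (1 - \<epsilon>) * ?N * p / 6}"
  let ?B = "{E. \<exists>H\<subseteq>E. (\<forall>v\<in>?V. card {e\<in>H. v \<in> e} \<le> ?N * p / 6) \<and> (?V, E - H) \<notin> HAM}"
  have N: "24 \<le> ?N" using n by simp
  have d: "10 ^ 30 * ln ?N \<le> ?N * p" using K N by (simp add: field_simps)
  have "exp 1 \<le> ?N" using e_less_272 N by linarith
  then have "ln (exp 1) \<le> ln ?N" using N by (subst ln_le_cancel_iff) auto
  then have ln: "1 \<le> ln ?N" by simp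
  have d30: "10 ^ 30 \<le> ?N * p" using d ln by simp
  have "measure_pmf.prob (binomial_random_graph n p) (- ?S) \<le>
      measure_pmf.prob (random_subset (pairs ?V) p) ?B"
    unfolding binomial_random_graph_eq measure_map_pmf vertex_pairs_def
  proof (rule measure_pmf.finite_measure_mono)
    show "Pair ?V -` (- ?S) \<subseteq> ?B"
    proof
      fix E assume "E \<in> Pair ?V -` (- ?S)"
      then have "real (local_resilience (?V, E) HAM) < (1 - \<epsilon>) * ?N * p / 6" by auto
      also have "\<dots> \<le> ?N * p / 6"
        using mult_right_mono[of "1 - \<epsilon>" 1 "?N * p"] \<open>0 < \<epsilon>\<close> p by (simp add: mult.assoc)
      finally obtain H where "H \<subseteq> E" "\<forall>v\<in>?V. card {e\<in>H. v \<in> e} < ?N * p / 6" "(?V, E - H) \<notin> HAM"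
        using local_resilience_HAM_less[OF finite_atLeastAtMost] by blast
      then show "E \<in> ?B" by (intro CollectI exI[of _ H]) (simp add: less_imp_le)
    qed
  qed simp
  also have "\<dots> \<le> ?N * exp (- p * (?N - 1) / 50) + ((1 + exp (- (?N * p) / 10 ^ 14)) ^ n - 1) +
      4 ^ n * exp (- (?N * (?N * p)) / 10 ^ 16) + 2 * exp (- (?N * (?N * p)) / 10 ^ 16)"
    using prob_deletion_not_HAM[of ?V p] p n d30 by simp
  also have "\<dots> \<le> ?N * exp (- 2 * ln ?N) + ((1 + exp (- 2 * ln ?N)) ^ n - 1) +
      4 ^ n * exp (- 2 * ?N * ln ?N) + 2 * exp (- 2 * ?N * ln ?N)"
  proof -
    have "- p * (?N - 1) / 50 = p / 50 - ?N * p / 50" by (simp add: field_simps)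
    then have "exp (- p * (?N - 1) / 50) \<le> exp (- 2 * ln ?N)" using d ln p(2) by simp
    then have "?N * exp (- p * (?N - 1) / 50) \<le> ?N * exp (- 2 * ln ?N)" by (rule mult_left_mono) simp
    moreover have "exp (- (?N * p) / 10 ^ 14) \<le> exp (- 2 * ln ?N)" using d ln by simp
    then have "(1 + exp (- (?N * p) / 10 ^ 14)) ^ n \<le> (1 + exp (- 2 * ln ?N)) ^ n"
      by (intro power_mono) (auto simp: add_nonneg_nonneg)
    moreover have "- (?N * (?N * p)) / 10 ^ 16 \<le> - 2 * ?N * ln ?N"
    proof -
      have "2 * 10 ^ 16 * ln ?N \<le> ?N * p" using d ln by simp
      then have "?N * (2 * 10 ^ 16 * ln ?N) \<le> ?N * (?N * p)" by (rule mult_left_mono) simp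
      then show ?thesis by (simp add: field_simps)
    qed
    then have "exp (- (?N * (?N * p)) / 10 ^ 16) \<le> exp (- 2 * ?N * ln ?N)" by simp
    then have "4 ^ n * exp (- (?N * (?N * p)) / 10 ^ 16) \<le> 4 ^ n * exp (- 2 * ?N * ln ?N)"
      "2 * exp (- (?N * (?N * p)) / 10 ^ 16) \<le> 2 * exp (- 2 * ?N * ln ?N)" by simp_all
    ultimately show ?thesis by linarith
  qed
  finally show ?thesis
    using measure_pmf.prob_compl[of ?S "binomial_random_graph n p"] by (simp add: Compl_eq_Diff_UNIV)
qed

theorem theorem5:
  shows "\<forall>\<epsilon>::real. \<epsilon> > 0 \<longrightarrow>
    (\<exists>K::real. K > 0 \<and>
      (\<forall>p::nat \<Rightarrow> real.
        (\<forall>n. 0 \<le> p n \<and> p n \<le> 1) \<longrightarrow>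
        (\<forall>\<^sub>F n in sequentially. p n \<ge> K * ln (real n) / real n) \<longrightarrow>
        (\<lambda>n. measure_pmf.prob (binomial_random_graph n (p n))
               {G. real (local_resilience G HAM) \<ge> (1 - \<epsilon>) * real n * p n / 6})
          \<longlonglongrightarrow> 1))"
proof (intro allI impI exI[of _ "10 ^ 30"] conjI)
  fix \<epsilon> :: real and p :: "nat \<Rightarrow> real"
  assume \<epsilon>: "0 < \<epsilon>" and p: "\<forall>n. 0 \<le> p n \<and> p n \<le> 1"
    and K: "\<forall>\<^sub>F n in sequentially. 10 ^ 30 * ln (real n) / real n \<le> p n"
  let ?P = "\<lambda>n. measure_pmf.prob (binomial_random_graph n (p n))
      {G. real (local_resilience G HAM) \<ge> (1 - \<epsilon>) * real n * p n / 6}"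
  let ?g = "\<lambda>n. 1 - (real n * exp (- 2 * ln (real n)) + ((1 + exp (- 2 * ln (real n))) ^ n - 1) +
      4 ^ n * exp (- 2 * real n * ln (real n)) + 2 * exp (- 2 * real n * ln (real n)))"
  show "?P \<longlonglongrightarrow> 1"
  \<comment> \<open>The error terms are n^(-1), (1 + n^(-2))^n - 1, (4/n^2)^n and 2n^(-2n), and all
    of them vanish in the limit.\<close>
  proof (rule tendsto_sandwich[of ?g ?P sequentially "\<lambda>_. 1"])
    show "\<forall>\<^sub>F n in sequentially. ?g n \<le> ?P n"
      using K eventually_ge_at_top[of 24]
      by eventually_elim (use p \<epsilon> in \<open>intro prob_local_resilience_HAM_ge, auto\<close>)
    show "?g \<longlonglongrightarrow> 1" by real_asymp
  qed auto
qed simp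

end
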